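(* Let $U$ be a nontrivial element of the free group $H$. (a) Suppose $\mathrm{genus}^+(U)=g<\infty$, and let $\phi:F\to H$ be a solution to $[x_1,y_1]\cdots[x_g,y_g]=U$. Then there is an irredundant orientable quadratic word $W\in F$ with $\mathrm{genus}^+(W)=g$ and a cancellation-free solution $\psi$ to $W=U$ such that for any automorphism $\gamma_W$ of $F$ with $W\gamma_W=[x_1,y_1]\cdots[x_g,y_g]$ there is an $\alpha\in\mathrm{Stab}([x_1,y_1]\cdots[x_g,y_g])$ such that $\phi=\alpha\gamma_W^{-1}\psi$. (b) Suppose $\mathrm{genus}^-(U)=g<\infty$ and $\mathrm{genus}^+(U)\ge g/2$, and let $\phi:F\to H$ be a solution to $x_1^2\cdots x_g^2=U$. Then there is an irredundant nonorientable quadratic word $W\in F$ with $\mathrm{genus}^-(W)=g$ and a cancellation-free solution $\psi$ to $W=U$ such that for any automorphism $\gamma_W$ of $F$ with $W\gamma_W=x_1^2\cdots x_g^2$ there is an $\alpha\in\mathrm{Stab}(x_1^2\cdots x_g^2)$ such that $\phi=\alpha\gamma_W^{-1}\psi$. In both parts the equality $\phi=\alpha\gamma_W^{-1}\psi$ is understood on the variables occurring in the left-hand side of the equation solved by $\phi$ (that is, on $x_1,y_1,\dots,x_g,y_g$ in (a) and on $x_1,\dots,x_g$ in (b)).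
   Context: $H$ is the free group on the countably infinite set of constants $A=\{a_1,a_2,\dots,b_1,b_2,\dots,c_1,c_2,\dots\}$, and $F$ is the free group on the countably infinite set of variables $X=\{x_1,x_2,\dots,y_1,y_2,\dots\}$. Elements of $X\cup X^{-1}$ are called letters. Elements of free groups are identified with freely reduced words. $[x,y]=x^{-1}y^{-1}xy$. Maps are written on the right and composed left to right: $x(\alpha\beta)=(x\alpha)\beta$. For a group $G$, $G'$ is the commutator subgroup and $2G$ is the subgroup generated by all squares. For $U\in G'$, $\mathrm{genus}^+(U)$ is the minimal number of commutators of which $U$ is a product; $\mathrm{genus}^+(U)=\infty$ if $U\notin G'$. For $U\in 2G$, $\mathrm{genus}^-(U)$ is the minimal number of squares of which $U$ is a product; $\mathrm{genus}^-(U)=\infty$ if $U\notin 2G$. Also $\mathrm{genus}^+(1)=\mathrm{genus}^-(1)=0$. Genera of elements of $F$ are computed in $F$, and genera of elements of $H$ in $H$. A word $W\in F$ is quadratic if each variable occurring in $W$ occurs exactly twice, with exponents $+1$ or $-1$. A quadratic word $W$ is orientable if $W\in F'$, and nonorientable otherwise. A quadratic word $W$ is irredundant if there is no pair of distinct, noninverse letters $x,y$ which appear in $W$ only in subwords $(xy)^{\pm1}$. For $W\in F$ and $U\in H$, a solution to $W=U$ is a homomorphism $\phi:F\to H$ with $W\phi=U$. Images under a solution of variables not occurring in $W$ are regarded as irrelevant. A solution $\phi$ to $W=U$ is cancellation-free if $x\phi\neq1$ for each variable $x$ occurring in $W$, and substituting for each letter of $W$ the reduced word representing its image under $\phi$ yields,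 without any cancellation, exactly the reduced word $U$ (equality in the free semigroup on $A\cup A^{-1}$). For $Q=[x_1,y_1]\cdots[x_g,y_g]$ or $Q=x_1^2\cdots x_g^2$, $\mathrm{Stab}(Q)$ is the group of automorphisms $\alpha$ with $Q\alpha=Q$ of $F$ or, equivalently for the purposes here, of the subgroup $F_Q$ of $F$ generated by the variables occurring in $Q$ (each automorphism of $F$ fixing such a $Q$ restricts to an automorphism of $F_Q$). *)

theory Defs
  imports "HOL-Algebra.Bij" "HOL-Algebra.Generated_Groups" "HOL-Library.Extended_Nat"
begin

text \<open>The letter (x, True) stands for the generator x and (x, False) for its inverse.\<close>

type_synonym 'a letter = "'a \<times> bool"

definition inv_letter :: "'a letter \<Rightarrow> 'a letter" where
  "inv_letter p = (fst p, \<not> snd p)"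

definition reduced :: "'a letter list \<Rightarrow> bool" where
  "reduced w \<longleftrightarrow> successively (\<lambda>p q. q \<noteq> inv_letter p) w"

fun cons_cancel :: "'a letter \<Rightarrow> 'a letter list \<Rightarrow> 'a letter list" where
  "cons_cancel p [] = [p]"
| "cons_cancel p (q # w) = (if q = inv_letter p then w else p # q # w)"

definition reduce :: "'a letter list \<Rightarrow> 'a letter list" where
  "reduce w = foldr cons_cancel w []"

definition free_group :: "'a letter list monoid" where
  "free_group = \<lparr>carrier = {w. reduced w}, mult = (\<lambda>u v. reduce (u @ v)), one = []\<rparr>"

definition gen :: "'a \<Rightarrow> 'a letter list" where
  "gen x = [(x, True)]"

definition vars :: "'a letter list \<Rightarrow> 'a set" where
  "vars w = fst ` set w"

lemma inv_letter_inv_letter [simp]: "inv_letter (inv_letter p) = p"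
  by (simp add: inv_letter_def)

lemma inv_letter_eq_iff [simp]: "inv_letter p = inv_letter q \<longleftrightarrow> p = q"
  by (metis inv_letter_inv_letter)

lemma reduced_Nil [simp]: "reduced []"
  by (simp add: reduced_def)

lemma reduced_Cons: "reduced (p # w) \<Longrightarrow> reduced w"
  by (cases w) (auto simp: reduced_def)

lemma reduced_cons_cancel: "reduced w \<Longrightarrow> reduced (cons_cancel p w)"
  by (cases w) (auto simp: reduced_def dest: reduced_Cons[unfolded reduced_def])

lemma cons_cancel_inverse:
  "reduced w \<Longrightarrow> cons_cancel p (cons_cancel (inv_letter p) w) = w"
  by (cases w rule: remdups_adj.cases) (auto simp: reduced_def)

lemma reduced_foldr: "reduced v \<Longrightarrow> reduced (foldr cons_cancel u v)"
  by (induction u) (auto intro: reduced_cons_cancel)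

lemma reduced_reduce [simp]: "reduced (reduce w)"
  by (simp add: reduce_def reduced_foldr)

lemma reduce_reduced: "reduced w \<Longrightarrow> reduce w = w"
proof (induction w)
  case (Cons p w)
  then have "reduce w = w"
    using reduced_Cons by blast
  with Cons.prems show ?case
    by (cases w) (auto simp: reduce_def reduced_def)
qed (simp add: reduce_def)

lemma foldr_cons_cancel:
  "reduced v \<Longrightarrow> foldr cons_cancel (cons_cancel p u) v = cons_cancel p (foldr cons_cancel u v)"
proof (cases u)
  case (Cons q w)
  assume v: "reduced v"
  show ?thesis
    using Cons cons_cancel_inverse[OF reduced_foldr[OF v]] by auto
qed simp

lemma foldr_reduce: "reduced v \<Longrightarrow> foldr cons_cancel (reduce u) v = foldr cons_cancel u v"
  by (induction u) (simp_all add: reduce_def foldr_cons_cancel)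

lemma reduce_append: "reduce (u @ v) = foldr cons_cancel u (reduce v)"
  by (simp add: reduce_def)

lemma foldr_cons_cancel_assoc:
  assumes "reduced v" "reduced w"
  shows "foldr cons_cancel (foldr cons_cancel u v) w = foldr cons_cancel u (foldr cons_cancel v w)"
  using foldr_reduce[OF assms(2), of "u @ v"] assms(1)
  by (simp add: reduce_append reduce_reduced)

lemma reduce_inverse: "reduce (rev (map inv_letter w) @ w) = []"
proof -
  have "foldr cons_cancel (rev (map inv_letter w)) (foldr cons_cancel w v) = v"
    if "reduced v" for v
    using that
  proof (induction w arbitrary: v)
    case (Cons p w)
    have "cons_cancel (inv_letter p) (cons_cancel p (foldr cons_cancel w v)) = foldr cons_cancel w v"
      using cons_cancel_inverse[OF reduced_foldr[OF Cons.prems], of "inv_letter p" w] by simp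
    with Cons show ?case by simp
  qed simp
  from this[of "[]"] show ?thesis
    by (simp add: reduce_def)
qed

lemma reduced_inverse:
  assumes "reduced w" shows "reduced (rev (map inv_letter w))"
proof -
  have "successively (\<lambda>p q. p \<noteq> inv_letter q) (map inv_letter w)"
    using assms unfolding reduced_def successively_map
    by (rule successively_mono) (metis inv_letter_inv_letter)
  then show ?thesis
    by (simp add: reduced_def successively_rev)
qed

lemma group_free_group: "group free_group"
proof (rule groupI)
  fix u v w :: "'a letter list"
  assume "u \<in> carrier free_group" "v \<in> carrier free_group" "w \<in> carrier free_group"
  then show "u \<otimes>\<^bsub>free_group\<^esub> v \<otimes>\<^bsub>free_group\<^esub> w = u \<otimes>\<^bsub>free_group\<^esub> (v \<otimes>\<^bsub>free_group\<^esub> w)"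
    by (simp add: free_group_def reduce_append foldr_cons_cancel_assoc reduce_reduced reduced_foldr)
next
  fix w :: "'a letter list"
  assume "w \<in> carrier free_group"
  then show "\<exists>v\<in>carrier free_group. v \<otimes>\<^bsub>free_group\<^esub> w = \<one>\<^bsub>free_group\<^esub>"
    by (intro bexI[of _ "rev (map inv_letter w)"])
      (auto simp: free_group_def reduce_inverse reduced_inverse)
qed (auto simp: free_group_def reduce_reduced)

definition commutator :: "('a, 'b) monoid_scheme \<Rightarrow> 'a \<Rightarrow> 'a \<Rightarrow> 'a" where
  "commutator G x y = inv\<^bsub>G\<^esub> x \<otimes>\<^bsub>G\<^esub> inv\<^bsub>G\<^esub> y \<otimes>\<^bsub>G\<^esub> x \<otimes>\<^bsub>G\<^esub> y"

definition commutators :: "('a, 'b) monoid_scheme \<Rightarrow> 'a set" where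
  "commutators G = {commutator G x y | x y. x \<in> carrier G \<and> y \<in> carrier G}"

definition squares :: "('a, 'b) monoid_scheme \<Rightarrow> 'a set" where
  "squares G = {x \<otimes>\<^bsub>G\<^esub> x | x. x \<in> carrier G}"

definition list_prod :: "('a, 'b) monoid_scheme \<Rightarrow> 'a list \<Rightarrow> 'a" where
  "list_prod G us = foldr (\<otimes>\<^bsub>G\<^esub>) us \<one>\<^bsub>G\<^esub>"

definition min_factors :: "('a, 'b) monoid_scheme \<Rightarrow> 'a set \<Rightarrow> 'a \<Rightarrow> nat" where
  "min_factors G S u = (LEAST n. \<exists>us. length us = n \<and> set us \<subseteq> S \<and> list_prod G us = u)"

definition genus_plus :: "('a, 'b) monoid_scheme \<Rightarrow> 'a \<Rightarrow> enat" where
  "genus_plus G u =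
     (if u \<in> derived G (carrier G) then enat (min_factors G (commutators G) u) else \<infinity>)"

definition genus_minus :: "('a, 'b) monoid_scheme \<Rightarrow> 'a \<Rightarrow> enat" where
  "genus_minus G u =
     (if u \<in> generate G (squares G) then enat (min_factors G (squares G) u) else \<infinity>)"

text \<open>The index i of a constructor stands for the mathematical index i + 1, so that
  X 0, Y 0, X 1, Y 1, ... are the variables x1, y1, x2, y2, ...\<close>

datatype const = A nat | B nat | C nat

datatype variable = X nat | Y nat

abbreviation FreeX :: "variable letter list monoid" where "FreeX \<equiv> free_group"

abbreviation FreeA :: "const letter list monoid" where "FreeA \<equiv> free_group"

definition quadratic :: "variable letter list \<Rightarrow> bool" where
  "quadratic W \<longleftrightarrow> W \<in> carrier FreeX \<and> (\<forall>x\<in>vars W. count_list (map fst W) x = 2)"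

definition orientable :: "variable letter list \<Rightarrow> bool" where
  "orientable W \<longleftrightarrow> W \<in> derived FreeX (carrier FreeX)"

text \<open>Every occurrence in W of one of the letters p, q or their inverses lies inside an
  occurrence of the two-letter word pq or of its inverse.\<close>

definition only_in_pair :: "variable letter list \<Rightarrow> variable letter \<Rightarrow> variable letter \<Rightarrow> bool" where
  "only_in_pair W p q \<longleftrightarrow>
     (\<forall>i<length W. W ! i \<in> {p, q, inv_letter p, inv_letter q} \<longrightarrow>
        (\<exists>j. j \<le> i \<and> i \<le> Suc j \<and> Suc j < length W \<and>
             ((W ! j = p \<and> W ! Suc j = q) \<or>
              (W ! j = inv_letter q \<and> W ! Suc j = inv_letter p))))"

definition irredundant :: "variable letter list \<Rightarrow> bool" where
  "irredundant W \<longleftrightarrow>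
     \<not> (\<exists>p q. fst p \<in> vars W \<and> fst q \<in> vars W \<and> p \<noteq> q \<and> p \<noteq> inv_letter q \<and> only_in_pair W p q)"

definition solution ::
  "(variable letter list \<Rightarrow> const letter list) \<Rightarrow> variable letter list \<Rightarrow> const letter list \<Rightarrow> bool"
  where "solution \<phi> W U \<longleftrightarrow> \<phi> \<in> hom FreeX FreeA \<and> \<phi> W = U"

text \<open>The concatenation is in the free monoid, without reduction; [l] is the letter l as an
  element of the free group.\<close>

definition cancellation_free ::
  "(variable letter list \<Rightarrow> const letter list) \<Rightarrow> variable letter list \<Rightarrow> const letter list \<Rightarrow> bool"
  where "cancellation_free \<phi> W U \<longleftrightarrow>
    (\<forall>x\<in>vars W. \<phi> (gen x) \<noteq> \<one>\<^bsub>FreeA\<^esub>) \<and> concat (map (\<lambda>l. \<phi> [l]) W) = U"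

definition commutator_word :: "nat \<Rightarrow> variable letter list" where
  "commutator_word g =
     list_prod FreeX (map (\<lambda>i. commutator FreeX (gen (X i)) (gen (Y i))) [0..<g])"

definition square_word :: "nat \<Rightarrow> variable letter list" where
  "square_word g = list_prod FreeX (map (\<lambda>i. gen (X i) \<otimes>\<^bsub>FreeX\<^esub> gen (X i)) [0..<g])"

definition Stab :: "variable letter list \<Rightarrow> (variable letter list \<Rightarrow> variable letter list) set" where
  "Stab Q = {\<alpha> \<in> auto FreeX. \<alpha> Q = Q}"

end

theory Submission
  imports Defs
begin

text \<open>
  Among all pairs of a quadratic word W in the automorphism orbit of the standard word Q and a
  solution of W = U obtained from \<phi> by the corresponding automorphism, take one in which the
  images of the variables of W have least total weight. If two adjacent letters of W cancelled
  in their images, the cancelling letter could be split off as the image of a fresh variable; if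
  two letters occurred only as a pair, they could be merged. Both lower the weight. A variable x
  with trivial image is removed by contracting the edge x of the surface of W, unless x
  is a loop. In that case erasing x lowers the rank of the mod 2 form of W, and the normal form of
  the resulting word contradicts the minimality of the genus of U; if the word becomes orientable
  although Q is not, this is where the lower bound on the other genus is used. Once W is found,
  the automorphism \<delta> with Q \<delta> = W gives \<alpha> = \<delta> \<gamma> for every \<gamma> with W \<gamma> = Q.

  Words are handled as unreduced lists modulo free reduction. The mod 2 form of a word w at
  vectors u, v is the corner entry of the image of w in the group of unitriangular 3 by 3 matrices
  over Z/2, where each variable x is sent to the matrix with entries u(x), v(x) and corner 0;
  vectors over Z/2 are sets of variables.
\<close>

subsection \<open>Free reduction and substitution\<close>

text \<open>Gluing the sides of the polygon of W gives a closed surface, on which the mod 2 form is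
  the cup product of 1-cochains. Its radical consists of the coboundaries of vertex functions, so
  its rank is that of the first cohomology: twice the number of commutators for an orientable W, the
  number of squares otherwise. Genus can thus be compared before and after erasing a variable
  without building a surface, and cardinalities of radicals replace dimensions. An edge x is not a
  loop exactly when some coboundary contains it. Such a cut is also what contraction consumes, so
  one contraction lemma serves both a trivial image (any cut through x) and a redundant pair pq (the
  cut around the vertex between p and q). The obstacle in the descent is that splitting off a
  cancelling letter enlarges the set of variables.\<close>

definition weq :: "'a letter list \<Rightarrow> 'a letter list \<Rightarrow> bool"  (infix "\<cong>\<^sub>F" 50) where
  "u \<cong>\<^sub>F v \<longleftrightarrow> reduce u = reduce v"

definition winv :: "'a letter list \<Rightarrow> 'a letter list" where
  "winv w = rev (map inv_letter w)"

text \<open>Nothing is reduced here: compatibility with concatenation, inversion and composition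
  then holds as plain equations, and freedom from cancellation is simply reducedness of
  \<open>ext \<psi> W\<close>.\<close>

definition ext :: "('a \<Rightarrow> 'b letter list) \<Rightarrow> 'a letter list \<Rightarrow> 'b letter list" where
  "ext f w = concat (map (\<lambda>p. if snd p then f (fst p) else winv (f (fst p))) w)"

lemma weq_refl [simp, intro]: "u \<cong>\<^sub>F u"
  by (simp add: weq_def)

lemma weq_sym: "u \<cong>\<^sub>F v \<Longrightarrow> v \<cong>\<^sub>F u"
  by (simp add: weq_def)

lemma weq_trans [trans]: "u \<cong>\<^sub>F v \<Longrightarrow> v \<cong>\<^sub>F w \<Longrightarrow> u \<cong>\<^sub>F w"
  by (simp add: weq_def)

lemma reduce_reduce_append: "reduce (reduce u @ reduce v) = reduce (u @ v)"
proof -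
  have "reduce (reduce u @ reduce v) = foldr cons_cancel (reduce u) (reduce v)"
    by (simp add: reduce_append reduce_reduced)
  also have "\<dots> = reduce (u @ v)"
    by (simp add: foldr_reduce reduce_append)
  finally show ?thesis .
qed

lemma weq_append: "u \<cong>\<^sub>F u' \<Longrightarrow> v \<cong>\<^sub>F v' \<Longrightarrow> u @ v \<cong>\<^sub>F u' @ v'"
  by (metis weq_def reduce_reduce_append)

lemma weq_reduce [simp, intro]: "reduce u \<cong>\<^sub>F u"
  by (simp add: weq_def reduce_reduced)

lemma weq_cancel: "a @ p # inv_letter p # b \<cong>\<^sub>F a @ b"
proof -
  have "p # inv_letter p # b \<cong>\<^sub>F b"
    using cons_cancel_inverse[of "reduce b" p] by (simp add: weq_def reduce_def reduced_foldr)
  then show ?thesis by (simp add: weq_append)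
qed

lemma winv_simps [simp]:
  "winv [] = []" "winv (u @ v) = winv v @ winv u" "winv (winv u) = u"
  "winv (p # u) = winv u @ [inv_letter p]" "length (winv u) = length u"
  by (simp_all add: winv_def rev_map o_def)

lemma weq_winv_left: "winv u @ u \<cong>\<^sub>F []"
  using reduce_inverse[of u] by (simp add: weq_def winv_def reduce_def)

lemma weq_winv_right: "u @ winv u \<cong>\<^sub>F []"
  using weq_winv_left[of "winv u"] by simp

lemma winv_cancel: "a @ u @ winv u @ b \<cong>\<^sub>F a @ b" "a @ winv u @ u @ b \<cong>\<^sub>F a @ b"
  using weq_append[OF weq_refl weq_append[OF weq_winv_right weq_refl], of a u b]
    weq_append[OF weq_refl weq_append[OF weq_winv_left weq_refl], of a u b] by simp_all

lemma vars_simps [simp]: "vars [] = {}" "vars (p # u) = insert (fst p) (vars u)"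
  "vars (u @ v) = vars u \<union> vars v" "vars (winv u) = vars u" "finite (vars u)"
  by (auto simp: vars_def winv_def inv_letter_def image_iff Bex_def)

lemma fst_inv_letter [simp]: "fst (inv_letter p) = fst p"
  by (simp add: inv_letter_def)

lemma snd_inv_letter [simp]: "snd (inv_letter p) = (\<not> snd p)"
  by (simp add: inv_letter_def)

lemma inv_letter_neq [simp]: "inv_letter p \<noteq> p" "p \<noteq> inv_letter p"
  by (auto simp: inv_letter_def prod_eq_iff)

lemma vars_cons_cancel: "vars (cons_cancel p u) \<subseteq> insert (fst p) (vars u)"
  by (cases u) auto

lemma vars_reduce: "vars (reduce u) \<subseteq> vars u"
  by (induction u) (use vars_cons_cancel in \<open>fastforce simp: reduce_def\<close>)+

lemma length_reduce: "length (reduce u) \<le> length u"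
proof (induction u)
  case (Cons p u)
  have "length (cons_cancel p v) \<le> Suc (length v)" for v
    by (cases v) auto
  from this[of "reduce u"] Cons show ?case by (simp add: reduce_def)
qed (simp add: reduce_def)

lemma ext_simps [simp]: "ext f [] = []" "ext f (u @ v) = ext f u @ ext f v"
  "ext f (p # u) = (if snd p then f (fst p) else winv (f (fst p))) @ ext f u"
  by (simp_all add: ext_def)

lemma ext_winv [simp]: "ext f (winv u) = winv (ext f u)"
  by (induction u) auto

lemma ext_ext: "ext g (ext f u) = ext (\<lambda>x. ext g (f x)) u"
  by (induction u) auto

lemma weq_winv: "u \<cong>\<^sub>F v \<Longrightarrow> winv u \<cong>\<^sub>F winv v"
proof -
  assume uv: "u \<cong>\<^sub>F v"
  have "winv u \<cong>\<^sub>F winv u @ (v @ winv v)"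
    using weq_append[OF weq_refl weq_winv_right[THEN weq_sym], of "winv u" v] by simp
  also have "\<dots> \<cong>\<^sub>F winv u @ (u @ winv v)"
    by (intro weq_append weq_refl weq_sym[OF uv])
  also have "\<dots> \<cong>\<^sub>F winv v"
    using weq_append[OF weq_winv_left weq_refl, of u "winv v"] by simp
  finally show ?thesis .
qed

lemma ext_cons_cancel: "ext f (cons_cancel p u) \<cong>\<^sub>F ext f (p # u)"
  using winv_cancel[of "[]", THEN weq_sym]
  by (cases u) (auto simp: inv_letter_def prod_eq_iff)

lemma ext_reduce: "ext f (reduce u) \<cong>\<^sub>F ext f u"
proof (induction u)
  case (Cons p u)
  have "ext f (reduce (p # u)) \<cong>\<^sub>F ext f (p # reduce u)"
    using ext_cons_cancel[of f p "reduce u"] by (simp only: reduce_def foldr.simps o_apply)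
  also have "\<dots> \<cong>\<^sub>F ext f (p # u)"
    using Cons by (auto intro: weq_append)
  finally show ?case .
qed (simp add: reduce_def)

lemma ext_weq: "u \<cong>\<^sub>F v \<Longrightarrow> ext f u \<cong>\<^sub>F ext f v"
  by (metis ext_reduce weq_def)

lemma ext_cong: "(\<And>x. x \<in> vars u \<Longrightarrow> f x \<cong>\<^sub>F g x) \<Longrightarrow> ext f u \<cong>\<^sub>F ext g u"
proof (induction u)
  case (Cons p u)
  then show ?case by (auto intro!: weq_append weq_winv)
qed simp

lemma ext_cong_eq: "(\<And>x. x \<in> vars u \<Longrightarrow> f x = g x) \<Longrightarrow> ext f u = ext g u"
  by (induction u) auto

lemma ext_id: "ext (\<lambda>x. [(x, True)]) u = u"
  by (induction u) (auto simp: inv_letter_def prod_eq_iff)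

text \<open>An automorphism is carried together with its inverse, both given on generators.
  Composition and bijectivity then come from substitution alone.\<close>

definition inv_subst :: "('a \<Rightarrow> 'a letter list) \<Rightarrow> ('a \<Rightarrow> 'a letter list) \<Rightarrow> bool" where
  "inv_subst s t \<longleftrightarrow> (\<forall>x. ext t (s x) \<cong>\<^sub>F [(x, True)]) \<and> (\<forall>x. ext s (t x) \<cong>\<^sub>F [(x, True)])"

lemma inv_subst_id: "inv_subst (\<lambda>x. [(x, True)]) (\<lambda>x. [(x, True)])"
  by (simp add: inv_subst_def)

lemma inv_subst_ext: "inv_subst s t \<Longrightarrow> ext t (ext s u) \<cong>\<^sub>F u"
  using ext_cong[of u "\<lambda>x. ext t (s x)" "\<lambda>x. [(x, True)]"]
  by (simp add: inv_subst_def ext_ext ext_id)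

lemma inv_subst_sym: "inv_subst s t \<Longrightarrow> inv_subst t s"
  by (simp add: inv_subst_def)

lemma inv_subst_comp:
  assumes "inv_subst s t" "inv_subst s' t'"
  shows "inv_subst (\<lambda>x. ext s' (s x)) (\<lambda>x. ext t (t' x))"
proof -
  have "ext (\<lambda>x. ext t (t' x)) (ext s' u) \<cong>\<^sub>F ext t u" for u
    using ext_weq[OF inv_subst_ext[OF assms(2), of u], of t] by (simp add: ext_ext)
  moreover have "ext (\<lambda>x. ext s' (s x)) (ext t u) \<cong>\<^sub>F ext s' u" for u
    using ext_weq[OF inv_subst_ext[OF inv_subst_sym[OF assms(1)], of u], of s'] by (simp add: ext_ext)
  ultimately show ?thesis
    using assms unfolding inv_subst_def by (meson weq_trans)
qed

text \<open>The substitution that sends the letter p, which may be an inverse, to L.\<close>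

definition upd :: "'a letter \<Rightarrow> 'b letter list \<Rightarrow> ('a \<Rightarrow> 'b letter list) \<Rightarrow> 'a \<Rightarrow> 'b letter list" where
  "upd p L f = f(fst p := (if snd p then L else winv L))"

subsection \<open>Parity and the mod 2 form\<close>

fun par :: "'a set \<Rightarrow> 'a letter list \<Rightarrow> bool" where
  "par v [] = False"
| "par v (p # u) = ((fst p \<in> v) \<noteq> par v u)"

text \<open>The extra term for an inverse letter is the corner of an inverse unitriangular matrix,
  the product of the two off-diagonal entries. \<open>om_append\<close> is matrix multiplication in
  the corner.\<close>

fun om :: "'a set \<Rightarrow> 'a set \<Rightarrow> 'a letter list \<Rightarrow> bool" where
  "om v w [] = False"
| "om v w (p # u) = ((fst p \<in> v \<and> (par w u \<noteq> (\<not> snd p \<and> fst p \<in> w))) \<noteq> om v w u)"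

lemma par_append [simp]: "par v (a @ b) = (par v a \<noteq> par v b)"
  by (induction a) auto

lemma om_append [simp]: "om v w (a @ b) = (om v w a \<noteq> (om v w b \<noteq> (par v a \<and> par w b)))"
  by (induction a) auto

lemma par_winv [simp]: "par v (winv a) = par v a"
  by (induction a) auto

lemma om_winv [simp]: "om v w (winv a) = (om v w a \<noteq> (par v a \<and> par w a))"
  by (induction a) auto

lemma par_cons_cancel: "par v (cons_cancel p u) = par v (p # u)"
  by (cases u) auto

lemma om_cons_cancel: "om v w (cons_cancel p u) = om v w (p # u)"
  by (cases u) auto

lemma par_reduce: "par v (reduce u) = par v u"
  by (induction u) (auto simp: reduce_def par_cons_cancel)

lemma om_reduce: "om v w (reduce u) = om v w u"
  by (induction u) (auto simp: reduce_def om_cons_cancel par_reduce[unfolded reduce_def])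

lemma om_weq: "u \<cong>\<^sub>F u' \<Longrightarrow> om v w u = om v w u'"
  by (metis om_reduce weq_def)

lemma par_cong: "v \<inter> vars u = v' \<inter> vars u \<Longrightarrow> par v u = par v' u"
  by (induction u) (auto; blast)+

lemma om_cong: "v \<inter> vars u = v' \<inter> vars u \<Longrightarrow> w \<inter> vars u = w' \<inter> vars u \<Longrightarrow> om v w u = om v' w' u"
proof (induction u)
  case (Cons p u)
  have "par w u = par w' u" "om v w u = om v' w' u"
    using Cons by (auto intro!: par_cong Cons.IH)
  moreover have "fst p \<in> v \<longleftrightarrow> fst p \<in> v'" "fst p \<in> w \<longleftrightarrow> fst p \<in> w'"
    using Cons.prems by auto
  ultimately show ?case by simp
qed simp

subsection \<open>Quadratic lists\<close>

abbreviation cnt :: "'a letter list \<Rightarrow> 'a \<Rightarrow> nat" where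
  "cnt w \<equiv> count_list (map fst w)"

definition qlist :: "'a letter list \<Rightarrow> bool" where
  "qlist w \<longleftrightarrow> (\<forall>x. cnt w x = 0 \<or> cnt w x = 2)"

lemma cnt_winv [simp]: "cnt (winv u) = cnt u"
  by (induction u) (auto simp: fun_eq_iff)

lemma cnt_0_iff: "cnt u x = 0 \<longleftrightarrow> x \<notin> vars u"
  by (auto simp: count_list_0_iff vars_def)

lemma cnt_notin [simp]: "x \<notin> vars u \<Longrightarrow> cnt u x = 0"
  by (simp add: cnt_0_iff)

lemma qlist_altdef: "qlist w \<longleftrightarrow> (\<forall>x\<in>vars w. cnt w x = 2)"
  unfolding qlist_def by (metis cnt_0_iff zero_neq_numeral)

lemma qlist_fresh:
  assumes "qlist (a @ p # b @ q # c)" "fst p = fst q"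
  shows "fst p \<notin> vars a" "fst p \<notin> vars b" "fst p \<notin> vars c"
proof -
  have "cnt (a @ p # b @ q # c) (fst p) = 0 \<or> cnt (a @ p # b @ q # c) (fst p) = 2"
    using assms(1) unfolding qlist_def by blast
  then have "cnt a (fst p) = 0 \<and> cnt b (fst p) = 0 \<and> cnt c (fst p) = 0"
    using assms(2) by auto
  then show "fst p \<notin> vars a" "fst p \<notin> vars b" "fst p \<notin> vars c"
    by (auto simp: cnt_0_iff)
qed

lemma qlist_remove: "qlist (a @ p # b @ q # c) \<Longrightarrow> fst p = fst q \<Longrightarrow> qlist (a @ b @ c)"
  unfolding qlist_def
proof
  fix x
  assume q: "\<forall>x. cnt (a @ p # b @ q # c) x = 0 \<or> cnt (a @ p # b @ q # c) x = 2" and "fst p = fst q"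
  then show "cnt (a @ b @ c) x = 0 \<or> cnt (a @ b @ c) x = 2"
    by (cases "x = fst p") (use spec[OF q, of x] in auto)
qed

lemma qlist_split:
  assumes "qlist w" "x \<in> vars w"
  obtains a p b q c where "w = a @ p # b @ q # c" "fst p = x" "fst q = x"
    "x \<notin> vars a" "x \<notin> vars b" "x \<notin> vars c"
proof -
  from assms(2) obtain p where p: "p \<in> set w" "fst p = x" by (auto simp: vars_def)
  then obtain a r where w: "w = a @ p # r" by (meson split_list)
  have two: "cnt w x = 2" using assms by (auto simp: qlist_altdef)
  consider "x \<in> vars r" | "x \<in> vars a"
    using two p(2) unfolding w by (cases "x \<in> vars r"; cases "x \<in> vars a") auto
  then show ?thesis
  proof cases
    case 1
    then obtain q where q: "q \<in> set r" "fst q = x" by (auto simp: vars_def)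
    then obtain b c where "r = b @ q # c" by (meson split_list)
    with w have "w = a @ p # b @ q # c" by simp
    with p q qlist_fresh[of a p b q c] assms(1) that show ?thesis by auto
  next
    case 2
    then obtain q where q: "q \<in> set a" "fst q = x" by (auto simp: vars_def)
    then obtain b c where "a = b @ q # c" by (meson split_list)
    with w have "w = b @ q # c @ p # r" by simp
    with p q qlist_fresh[of b q c p r] assms(1) that show ?thesis by auto
  qed
qed

text \<open>Mod 2 every cochain is a cocycle. In the contraction this makes the potential return to
  its initial value once the whole boundary has been read.\<close>

lemma qlist_even_par: "qlist w \<Longrightarrow> \<not> par v w"
proof (induction "length w" arbitrary: w rule: less_induct)
  case less
  show ?case
  proof (cases w)
    case (Cons s w')
    then obtain a p b q c where w: "w = a @ p # b @ q # c" and pq: "fst p = fst s" "fst q = fst s"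
      using qlist_split[OF less.prems, of "fst s"] by (metis insertI1 vars_simps(2))
    with qlist_remove[of a p b q c] less.prems have "qlist (a @ b @ c)" by simp
    with less.hyps[of "a @ b @ c"] w pq show ?thesis by auto
  qed simp
qed

subsection \<open>Radical vectors and contraction\<close>

text \<open>The parity of the prefix before a letter is the potential of a vertex of the surface
  of w; tail normalises it to the initial vertex of the underlying edge.\<close>

definition tail :: "'a set \<Rightarrow> 'a letter list \<Rightarrow> 'a letter \<Rightarrow> bool" where
  "tail v a p = (par v a \<noteq> (\<not> snd p \<and> fst p \<in> v))"

text \<open>A vertex function with coboundary v, normalised to vanish at the start of w:
  \<open>pot y\<close> is its value at the initial vertex of the edge y. The condition is that both
  occurrences of y see the same value.\<close>

definition potential :: "'a letter list \<Rightarrow> 'a set \<Rightarrow> ('a \<Rightarrow> bool) \<Rightarrow> bool" where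
  "potential w v pot \<longleftrightarrow> (\<forall>a p b. w = a @ p # b \<longrightarrow> tail v a p = pot (fst p))"

definition radical :: "'a letter list \<Rightarrow> 'a set \<Rightarrow> bool" where
  "radical w v \<longleftrightarrow> (\<forall>u. \<not> om v u w)"

lemma par_notin: "x \<notin> vars u \<Longrightarrow> \<not> par {x} u"
  by (induction u) auto

lemma om_notin: "x \<notin> vars u \<Longrightarrow> \<not> om v {x} u"
  by (induction u) (auto simp: par_notin)

text \<open>Pairing v with the single variable x gives the sum mod 2 of the tails at the two
  occurrences of x. If v is radical this sum is 0, so the tail depends on x alone.\<close>

lemma radical_potential:
  assumes "qlist w" "radical w v"
  shows "\<exists>pot. potential w v pot"
proof -
  have agree: "tail v a p = tail v (a @ p # b) q"
    if w: "w = a @ p # b @ q # c" and pq: "fst p = fst q" for a p b q c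
  proof -
    note fresh = qlist_fresh[OF assms(1)[unfolded w] pq]
    have "\<not> om v {fst p} (a @ p # b @ q # c)"
      using assms(2) by (simp add: radical_def w)
    then show ?thesis
      using par_notin[OF fresh(1)] par_notin[OF fresh(2)] par_notin[OF fresh(3)]
        om_notin[OF fresh(1)] om_notin[OF fresh(2)] om_notin[OF fresh(3)]
      by (simp add: tail_def pq) argo
  qed
  have agree': "tail v a p = tail v a' p'"
    if "w = a @ p # b" "w = a' @ p' # b'" and eq: "fst p = fst p'" for a p b a' p' b'
  proof -
    have "a @ (p # b) = a' @ (p' # b')"
      by (rule trans[OF that(1)[symmetric] that(2)])
    then have "(\<exists>c. a = a' @ c \<and> c @ p # b = p' # b') \<or> (\<exists>c. a' = a @ c \<and> c @ p' # b' = p # b)"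
      by (subst (asm) append_eq_append_conv2) metis
    then consider c where "a = a' @ c" "c @ p # b = p' # b'" | c where "a' = a @ c" "c @ p' # b' = p # b"
      by (elim disjE exE conjE)
    then show ?thesis
    proof cases
      case 1
      show ?thesis
      proof (cases c)
        case (Cons l d)
        then have "a = a' @ p' # d" using 1 by simp
        then show ?thesis using agree[of a' p' d p b] that(1) eq by simp
      qed (use 1 in simp)
    next
      case 2
      show ?thesis
      proof (cases c)
        case (Cons l d)
        then have "a' = a @ p # d" using 2 by simp
        then show ?thesis using agree[of a p d p' b'] that(2) eq by simp
      qed (use 2 in simp)
    qed
  qed
  define pot where "pot y \<longleftrightarrow> (\<exists>a p b. w = a @ p # b \<and> fst p = y \<and> tail v a p)" for y
  have "tail v a p = pot (fst p)" if w: "w = a @ p # b" for a p b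
  proof
    show "tail v a p \<Longrightarrow> pot (fst p)" unfolding pot_def using w by blast
    assume "pot (fst p)"
    then obtain a' p' b' where "w = a' @ p' # b'" "fst p' = fst p" "tail v a' p'"
      unfolding pot_def by blast
    then show "tail v a p" using agree'[of a' p' b' a p b] w by simp
  qed
  then show ?thesis unfolding potential_def by blast
qed

definition pw :: "bool \<Rightarrow> 'a letter \<Rightarrow> 'a letter list" where
  "pw b t = (if b then [t] else [])"

text \<open>The edge y becomes t^-e y t^f, where e and f are the potentials of its initial and
  terminal vertices. Reading w, these powers of t telescope at every vertex.\<close>

definition contr :: "'a set \<Rightarrow> ('a \<Rightarrow> bool) \<Rightarrow> 'a \<Rightarrow> 'a letter \<Rightarrow> 'a \<Rightarrow> 'a letter list" where
  "contr v pot x t y = (if y = x then [(x, True)]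
     else pw (pot y) (inv_letter t) @ (y, True) # pw (pot y \<noteq> (y \<in> v)) t)"

lemma pw_cancel: "pw b (inv_letter t) @ pw b t \<cong>\<^sub>F []" "pw b t @ pw b (inv_letter t) \<cong>\<^sub>F []"
  using weq_cancel[of "[]" t "[]"] weq_cancel[of "[]" "inv_letter t" "[]"] by (simp_all add: pw_def)

lemma inv_subst_contr:
  assumes "fst t = x"
  shows "inv_subst (contr v pot x t) (contr v pot x (inv_letter t))"
proof -
  have *: "ext (contr v pot x (inv_letter t)) (contr v pot x t y) \<cong>\<^sub>F [(y, True)]" if "fst t = x" for t y
  proof (cases "y = x")
    case False
    let ?c = "pot y" and ?d = "pot y \<noteq> (y \<in> v)"
    have l: "ext (contr v pot x (inv_letter t)) (pw b l) = pw b l" if "fst l = x" for b l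
      using that by (cases l) (auto simp: pw_def contr_def inv_letter_def)
    have "ext (contr v pot x (inv_letter t)) (contr v pot x t y) =
        (pw ?c (inv_letter t) @ pw ?c t) @ [(y, True)] @ (pw ?d (inv_letter t) @ pw ?d t)"
      using False that l[of t] l[of "inv_letter t"] by (simp add: contr_def)
    also have "\<dots> \<cong>\<^sub>F [] @ [(y, True)] @ []"
      by (intro weq_append pw_cancel weq_refl)
    finally show ?thesis by simp
  qed (simp add: contr_def)
  show ?thesis
    using *[OF assms] *[of "inv_letter t"] assms by (simp add: inv_subst_def)
qed

text \<open>After a prefix the pending factor is t to the potential of the vertex reached. The sign
  of t directs x towards potential 1, so an occurrence of x only creates or absorbs the pending
  factor and leaves no letter behind.\<close>

lemma ext_contr:
  assumes w: "potential w v pot" and x: "x \<in> v" and t: "t = (x, \<not> pot x)"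
  shows "w = a @ b \<Longrightarrow> ext (contr v pot x t) a \<cong>\<^sub>F filter (\<lambda>p. fst p \<noteq> x) a @ pw (par v a) t"
proof (induction a arbitrary: b rule: rev_induct)
  case (snoc p a)
  let ?s = "contr v pot x t" and ?f = "filter (\<lambda>p. fst p \<noteq> x)"
  have tl: "tail v a p = pot (fst p)"
    using w snoc.prems unfolding potential_def by (metis append.assoc append_Cons append_Nil)
  have IH: "ext ?s a \<cong>\<^sub>F ?f a @ pw (par v a) t"
    using snoc.IH[of "p # b"] snoc.prems by simp
  have step: "pw (par v a) t @ ext ?s [p] \<cong>\<^sub>F ?f [p] @ pw (par v (a @ [p])) t"
  proof (cases "fst p = x")
    case True
    then show ?thesis
      using tl x t weq_cancel[of "[]" "(x, True)" "[]"] weq_cancel[of "[]" "(x, False)" "[]"]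
      by (cases p) (auto simp: contr_def pw_def tail_def inv_letter_def)
  next
    case False
    have "pw (par v a) t @ ext ?s [p] =
        pw (par v a) t @ pw (par v a) (inv_letter t) @ p # pw (par v (a @ [p])) t"
      using False tl by (cases p) (auto simp: contr_def pw_def tail_def inv_letter_def)
    also have "\<dots> \<cong>\<^sub>F p # pw (par v (a @ [p])) t"
      using weq_append[OF pw_cancel(2) weq_refl] by simp
    finally show ?thesis using False by simp
  qed
  have "ext ?s (a @ [p]) \<cong>\<^sub>F ?f a @ (pw (par v a) t @ ext ?s [p])"
    using weq_append[OF IH weq_refl[of "ext ?s [p]"]] by simp
  also have "\<dots> \<cong>\<^sub>F ?f a @ (?f [p] @ pw (par v (a @ [p])) t)"
    by (rule weq_append[OF weq_refl step])
  finally show ?case by simp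
qed (simp add: pw_def)

lemma contraction:
  assumes "qlist w" "potential w v pot" "x \<in> v" "t = (x, \<not> pot x)"
  shows "ext (contr v pot x t) w \<cong>\<^sub>F filter (\<lambda>p. fst p \<noteq> x) w"
  using ext_contr[OF assms(2-4), of w "[]"] qlist_even_par[OF assms(1), of v] by (simp add: pw_def)

lemma cnt_filter: "cnt (filter (\<lambda>p. fst p \<noteq> x) w) y = (if y = x then 0 else cnt w y)"
  by (induction w) auto

lemma qlist_filter: "qlist w \<Longrightarrow> qlist (filter (\<lambda>p. fst p \<noteq> x) w)"
  by (simp add: qlist_def cnt_filter)

lemma vars_filter [simp]: "vars (filter (\<lambda>p. fst p \<noteq> x) w) = vars w - {x}"
  by (induction w) auto

subsection \<open>Rank of the mod 2 form\<close>

text \<open>The set S may exceed \<open>vars w\<close>: cancelling a pair of letters removes a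
  variable, but the radical over a fixed S stays the same. The rank is \<open>card S\<close> minus
  the binary logarithm of \<open>card (Rad S w)\<close>.\<close>

definition Rad :: "'a set \<Rightarrow> 'a letter list \<Rightarrow> 'a set set" where
  "Rad S w = {v \<in> Pow S. radical w v}"

lemma finite_Rad [simp]: "finite S \<Longrightarrow> finite (Rad S w)"
  by (simp add: Rad_def)

definition prodc :: "('a letter list \<times> 'a letter list) list \<Rightarrow> 'a letter list" where
  "prodc us = concat (map (\<lambda>(a, b). winv a @ winv b @ a @ b) us)"

definition prods :: "'a letter list list \<Rightarrow> 'a letter list" where
  "prods us = concat (map (\<lambda>a. a @ a) us)"

lemma prodc_simps [simp]: "prodc [] = []" "prodc ((a, b) # us) = winv a @ winv b @ a @ b @ prodc us"
  by (simp_all add: prodc_def)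

lemma prods_simps [simp]: "prods [] = []" "prods (a # us) = a @ a @ prods us"
  by (simp_all add: prods_def)

definition symd :: "'a set \<Rightarrow> 'a set \<Rightarrow> 'a set" where
  "symd v v' = (v - v') \<union> (v' - v)"

lemma par_empty [simp]: "\<not> par {} u"
  by (induction u) auto

lemma par_symd: "par (symd v v') u = (par v u \<noteq> par v' u)"
  by (induction u) (auto simp: symd_def)

lemma symd_cancel: "symd (symd v w) w = v"
  by (auto simp: symd_def)

section \<open>Upper bounds on the rank from products of squares or commutators\<close>

definition kernel :: "'a set \<Rightarrow> 'a letter list list \<Rightarrow> 'a set set" where
  "kernel S us = {v \<in> Pow S. \<forall>u\<in>set us. \<not> par v u}"

text \<open>One more parity condition at most halves the solution set: adding a fixed violating
  vector sends violating vectors injectively to satisfying ones.\<close>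

lemma card_kernel:
  assumes "finite S"
  shows "2 ^ card S \<le> card (kernel S us) * 2 ^ length us"
proof (induction us)
  case Nil
  then show ?case using card_Pow[OF assms] by (simp add: kernel_def Pow_def)
next
  case (Cons u us)
  have fin: "finite (kernel S us)" using assms by (simp add: kernel_def)
  have sub: "kernel S (u # us) \<subseteq> kernel S us" by (auto simp: kernel_def)
  have "card (kernel S us - kernel S (u # us)) \<le> card (kernel S (u # us))"
  proof (cases "kernel S us - kernel S (u # us) = {}")
    case True
    then show ?thesis by (metis card.empty zero_le)
  next
    case False
    then obtain v0 where v0: "v0 \<in> kernel S us" "par v0 u" by (auto simp: kernel_def)
    show ?thesis
    proof (rule card_inj_on_le)
      show "inj_on (\<lambda>v. symd v v0) (kernel S us - kernel S (u # us))"
        by (metis inj_onI symd_cancel)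
      show "(\<lambda>v. symd v v0) ` (kernel S us - kernel S (u # us)) \<subseteq> kernel S (u # us)"
      proof
        fix z assume "z \<in> (\<lambda>v. symd v v0) ` (kernel S us - kernel S (u # us))"
        then obtain v where v: "z = symd v v0" "v \<in> kernel S us" "v \<notin> kernel S (u # us)" by auto
        then have "z \<subseteq> S" using v0 by (auto simp: symd_def kernel_def)
        then show "z \<in> kernel S (u # us)" using v v0 by (auto simp: kernel_def par_symd)
      qed
      show "finite (kernel S (u # us))" using fin sub finite_subset by blast
    qed
  qed
  then have "card (kernel S us) \<le> 2 * card (kernel S (u # us))"
    using card_Diff_subset[OF finite_subset[OF sub fin] sub] card_mono[OF fin sub] by linarith
  then have "card (kernel S us) * 2 ^ length us \<le> 2 * card (kernel S (u # us)) * 2 ^ length us"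
    by (rule mult_le_mono1)
  from order_trans[OF Cons this] show ?case
    by (simp only: length_Cons power_Suc mult.assoc mult.commute mult.left_commute)
qed

lemma kernel_subset_Rad:
  assumes "\<And>v. (\<And>u. u \<in> set us \<Longrightarrow> \<not> par v u) \<Longrightarrow> radical w v" "finite S"
  shows "2 ^ card S \<le> card (Rad S w) * 2 ^ length us"
proof -
  have "kernel S us \<subseteq> Rad S w" using assms(1) by (auto simp: kernel_def Rad_def)
  then have "card (kernel S us) \<le> card (Rad S w)" using assms(2) by (simp add: card_mono)
  then have "card (kernel S us) * 2 ^ length us \<le> card (Rad S w) * 2 ^ length us" by simp
  with card_kernel[OF assms(2), of us] show ?thesis by linarith
qed

text \<open>The form of a product of squares is the sum of \<open>par v u\<close> times
  \<open>par x u\<close> over the factors u. A vector with even parity on all n factors is radical,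
  so the rank is at most n.\<close>

lemma rank_prods:
  assumes "w \<cong>\<^sub>F prods us" "finite S"
  shows "2 ^ card S \<le> card (Rad S w) * 2 ^ length us"
proof (rule kernel_subset_Rad[OF _ assms(2)])
  fix v assume *: "\<And>u. u \<in> set us \<Longrightarrow> \<not> par v u"
  have "\<not> om v x (prods us)" for x
    using * by (induction us) auto
  then show "radical w v" by (simp add: radical_def om_weq[OF assms(1)])
qed

text \<open>A commutator contributes the alternating form of its two entries, hence two parity
  conditions and rank at most 2.\<close>

lemma rank_prodc:
  assumes "w \<cong>\<^sub>F prodc us" "finite S"
  shows "2 ^ card S \<le> card (Rad S w) * 2 ^ (2 * length us)"
proof -
  have "2 ^ card S \<le> card (Rad S w) * 2 ^ length (map fst us @ map snd us)"
  proof (rule kernel_subset_Rad[OF _ assms(2)])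
    fix v assume *: "\<And>u. u \<in> set (map fst us @ map snd us) \<Longrightarrow> \<not> par v u"
    have "\<not> om v x (prodc us)" for x
      using * by (induction us) (auto simp: image_iff Bex_def)
    then show "radical w v" by (simp add: radical_def om_weq[OF assms(1)])
  qed
  then show ?thesis by (simp add: mult_2)
qed

section \<open>Splitting off a square or a commutator\<close>

lemma par_symd_single: "par (symd v {x}) u = (par v u \<noteq> odd (cnt u x))"
  by (induction u) (auto simp: symd_def)

lemma om_symd_notin: "x \<notin> vars u \<Longrightarrow> om v (symd w {x}) u = om v w u"
  by (intro om_cong) (auto simp: symd_def)

lemma radical_Diff_notin: "T \<inter> vars u = {} \<Longrightarrow> radical u (v - T) = radical u v"
  unfolding radical_def using om_cong[of "v - T" u v] by blast

text \<open>Pairing with {x} forces \<open>par v u\<close> to vanish for radical v. As x occurs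
  oddly often in u, this determines the coordinate of v at x from the others, so restriction is
  injective: the rank of w exceeds that of w' by at least 1.\<close>

lemma Rad_square:
  assumes w: "w \<cong>\<^sub>F u @ u @ w'" and x: "x \<notin> vars w'" "odd (cnt u x)" "x \<in> S" and S: "finite S"
  shows "card (Rad S w) \<le> card (Rad (S - {x}) w')"
proof -
  have om: "om v t w = ((par v u \<and> par t u) \<noteq> om v t w')" for v t
    using om_weq[OF w] by auto
  have rad: "\<not> par v u \<and> radical w' v" if "radical w v" for v
  proof -
    \<comment> \<open>\<open>symd {} {x}\<close> is the set {x}, written as a toggle of the empty
      set so that the lemmas on \<open>symd\<close> rewrite it.\<close>
    have "\<not> om v {} w" "\<not> om v (symd {} {x}) w" using that by (auto simp: radical_def)
    then have "\<not> par v u" using x by (simp add: om par_symd_single om_symd_notin)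
    with that show ?thesis by (simp add: radical_def om)
  qed
  show ?thesis
  proof (rule card_inj_on_le)
    show "inj_on (\<lambda>v. v - {x}) (Rad S w)"
    proof
      fix v v' assume "v \<in> Rad S w" "v' \<in> Rad S w" and eq: "v - {x} = v' - {x}"
      then have p: "\<not> par v u" "\<not> par v' u" using rad by (auto simp: Rad_def)
      have "v' = v \<or> v' = symd v {x}" using eq by (auto simp: symd_def)
      then show "v = v'" using p x(2) by (auto simp: par_symd_single)
    qed
    show "(\<lambda>v. v - {x}) ` Rad S w \<subseteq> Rad (S - {x}) w'"
      using rad x(1) by (auto simp: Rad_def radical_Diff_notin)
  qed (use S in simp)
qed

text \<open>Pairing with {x} gives even parity of v on b, pairing with {y} even parity on a. These
  two equations determine the coordinates at y and x, so the rank falls by at least 2.\<close>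

lemma Rad_commutator:
  assumes w: "w \<cong>\<^sub>F winv a @ winv b @ a @ b @ w'"
    and x: "x \<notin> vars w'" "odd (cnt a x)" "even (cnt b x)" "x \<in> S"
    and y: "y \<notin> vars w'" "odd (cnt b y)" "even (cnt a y)" "y \<in> S" and S: "finite S"
  shows "card (Rad S w) \<le> card (Rad (S - {x, y}) w')"
proof -
  have om: "om v t w = ((par v a \<and> par t b) \<noteq> ((par v b \<and> par t a) \<noteq> om v t w'))" for v t
    using om_weq[OF w] by auto
  have rad: "\<not> par v a \<and> \<not> par v b \<and> radical w' v" if "radical w v" for v
  proof -
    have "\<not> om v {} w" "\<not> om v (symd {} {x}) w" "\<not> om v (symd {} {y}) w"
      using that by (auto simp: radical_def)
    then have "\<not> par v a" "\<not> par v b"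
      using x y by (simp_all add: om par_symd_single om_symd_notin)
    with that show ?thesis by (simp add: radical_def om)
  qed
  show ?thesis
  proof (rule card_inj_on_le)
    show "inj_on (\<lambda>v. v - {x, y}) (Rad S w)"
    proof
      fix v v' assume "v \<in> Rad S w" "v' \<in> Rad S w" and eq: "v - {x, y} = v' - {x, y}"
      then have p: "\<not> par v a" "\<not> par v' a" "\<not> par v b" "\<not> par v' b"
        using rad by (auto simp: Rad_def)
      have "v' = v \<or> v' = symd v {x} \<or> v' = symd v {y} \<or> v' = symd (symd v {x}) {y}"
        using eq by (cases "x \<in> v"; cases "y \<in> v"; cases "x \<in> v'"; cases "y \<in> v'") (auto simp: symd_def)
      then show "v = v'" using p x y by (auto simp: par_symd_single)
    qed
    show "(\<lambda>v. v - {x, y}) ` Rad S w \<subseteq> Rad (S - {x, y}) w'"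
      using rad x(1) y(1) by (auto simp: Rad_def radical_Diff_notin)
  qed (use S in simp)
qed

subsection \<open>Normal forms\<close>

text \<open>Identities between words are verified on generators and transported by substitution.\<close>

lemma three_squares:
  "\<exists>p q r. u @ u @ winv b @ winv c @ b @ c \<cong>\<^sub>F p @ p @ q @ q @ r @ r"
proof -
  let ?f = "(!) [u, b, c]" and ?i = "\<lambda>n::nat. (n, True)" and ?j = "\<lambda>n::nat. (n, False)"
  \<comment> \<open>The generators 0, 1, 2 stand for u, b, c. With r = u b^-1 c^-1, p = u r c^-1
    r^-1 and q = r c r^-2 one has q^2 r^2 = r c r^-1 c, and multiplying by p^2 leaves u^2 [b,c].
    This is the surface identity that a torus plus a projective plane is three projective
    planes.\<close>
  let ?r = "[?i 0, ?j 1, ?j 2]"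
  let ?p = "?i 0 # ?r @ ?j 2 # winv ?r" and ?q = "?r @ ?i 2 # winv ?r @ winv ?r"
  have "[?i 0, ?i 0, ?j 1, ?j 2, ?i 1, ?i 2] \<cong>\<^sub>F ?p @ ?p @ ?q @ ?q @ ?r @ ?r"
    by (simp add: weq_def reduce_def inv_letter_def)
  from ext_weq[OF this, of ?f] have
    "u @ u @ winv b @ winv c @ b @ c \<cong>\<^sub>F ext ?f ?p @ ext ?f ?p @ ext ?f ?q @ ext ?f ?q @ ext ?f ?r @ ext ?f ?r"
    by simp
  then show ?thesis by blast
qed

text \<open>Each commutator is absorbed at the price of two further squares. The last of the three
  squares produced takes over the role of u, which is why u is arbitrary in the induction.\<close>

lemma square_times_commutators:
  "\<exists>us'. length us' = Suc (2 * length us) \<and> u @ u @ prodc us \<cong>\<^sub>F prods us'"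
proof (induction us arbitrary: u)
  case Nil
  show ?case by (rule exI[of _ "[u]"]) simp
next
  case (Cons bc us)
  obtain b c where bc: "bc = (b, c)" by force
  obtain p q r where pqr: "u @ u @ winv b @ winv c @ b @ c \<cong>\<^sub>F p @ p @ q @ q @ r @ r"
    using three_squares by blast
  obtain us' where us': "length us' = Suc (2 * length us)" "r @ r @ prodc us \<cong>\<^sub>F prods us'"
    using Cons by blast
  have "u @ u @ prodc (bc # us) \<cong>\<^sub>F (p @ p @ q @ q) @ (r @ r @ prodc us)"
    using weq_append[OF pqr weq_refl[of "prodc us"]] by (simp add: bc)
  also have "\<dots> \<cong>\<^sub>F prods (p # q # us')"
    using weq_append[OF weq_refl[of "p @ p @ q @ q"] us'(2)] by simp
  finally show ?case using us'(1) by (intro exI[of _ "p # q # us'"]) simp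
qed

text \<open>Cut and paste of a crosscap: both copies of x move into one conjugated square, and the
  arc b between them is reversed.\<close>

lemma square_identity:
  "a @ x @ b @ x @ c \<cong>\<^sub>F (a @ x @ b @ winv a) @ (a @ x @ b @ winv a) @ (a @ winv b @ c)"
proof -
  let ?f = "(!) [a, x, b, c]" and ?i = "\<lambda>n::nat. (n, True)" and ?j = "\<lambda>n::nat. (n, False)"
  have "[?i 0, ?i 1, ?i 2, ?i 1, ?i 3] \<cong>\<^sub>F
      [?i 0, ?i 1, ?i 2, ?j 0, ?i 0, ?i 1, ?i 2, ?j 0, ?i 0, ?j 2, ?i 3]"
    by (simp add: weq_def reduce_def inv_letter_def)
  from ext_weq[OF this, of ?f] show ?thesis by (simp add: numeral_3_eq_3)
qed

text \<open>Cut and paste of a handle: x and y survive only in the commutator, and the three arcs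
  between their occurrences are put in the opposite order.\<close>

lemma commutator_identity:
  fixes a b c d e x y
  defines "g \<equiv> a @ d @ c @ winv x @ winv a"
    and "h \<equiv> a @ d @ winv y @ winv b @ winv c @ winv d @ winv a"
  shows "a @ x @ b @ y @ c @ winv x @ d @ winv y @ e \<cong>\<^sub>F winv g @ winv h @ g @ h @ (a @ d @ c @ b @ e)"
proof -
  let ?f = "(!) [a, x, b, y, c, d, e]" and ?i = "\<lambda>n::nat. (n, True)" and ?j = "\<lambda>n::nat. (n, False)"
  let ?g = "[?i 0, ?i 5, ?i 4, ?j 1, ?j 0]" and ?h = "[?i 0, ?i 5, ?j 3, ?j 2, ?j 4, ?j 5, ?j 0]"
  have "[?i 0, ?i 1, ?i 2, ?i 3, ?i 4, ?j 1, ?i 5, ?j 3, ?i 6] \<cong>\<^sub>F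
      winv ?g @ winv ?h @ ?g @ ?h @ [?i 0, ?i 5, ?i 4, ?i 2, ?i 6]"
    by (simp add: weq_def reduce_def inv_letter_def)
  from ext_weq[OF this, of ?f] show ?thesis by (simp add: g_def h_def)
qed

lemma mate:
  assumes "distinct w" "qlist w" "p \<in> set w"
  shows "inv_letter p \<in> set w"
proof -
  obtain a r b s c where w: "w = a @ r # b @ s # c" and rs: "fst r = fst p" "fst s = fst p"
    and fresh: "fst p \<notin> vars a" "fst p \<notin> vars b" "fst p \<notin> vars c"
    using qlist_split[OF assms(2), of "fst p"] assms(3) by (metis image_eqI vars_def)
  have "p \<in> {r, s}" using assms(3) fresh by (auto simp: w vars_def)
  moreover have "r \<noteq> s" using assms(1) w by auto
  ultimately have "inv_letter p \<in> {r, s}"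
    using rs by (auto simp: inv_letter_def prod_eq_iff)
  then show ?thesis using w by auto
qed

text \<open>Take an innermost pair p, p^-1. It encloses some letter q, and q^-1 cannot be enclosed
  too, since that would be a closer pair; so the two pairs interleave.\<close>

lemma crossing:
  assumes w: "distinct w" "qlist w" "w \<noteq> []" and red: "\<And>a p b. w \<noteq> a @ p # inv_letter p # b"
  obtains a p b q c d e where "w = a @ p # b @ q # c @ inv_letter p # d @ inv_letter q # e"
proof -
  define P where "P n \<longleftrightarrow> (\<exists>a p b c. w = a @ p # b @ inv_letter p # c \<and> length b = n)" for n
  obtain p0 w0 where w0: "w = p0 # w0" using w(3) by (cases w) auto
  with mate[OF w(1,2), of p0] have "inv_letter p0 \<in> set w0" by auto
  then obtain b0 c0 where "w0 = b0 @ inv_letter p0 # c0" by (meson split_list)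
  then have "w = [] @ p0 # b0 @ inv_letter p0 # c0" using w0 by simp
  then have "\<exists>n. P n" unfolding P_def by blast
  then obtain n where n: "P n" and least: "\<And>m. m < n \<Longrightarrow> \<not> P m"
    using exists_least_iff[of P] by blast
  from n obtain a p b c where eq: "w = a @ p # b @ inv_letter p # c" and len: "length b = n"
    unfolding P_def by blast
  have "b \<noteq> []" using red[of a p c] eq by (intro notI) simp
  then obtain q b' where b: "b = q # b'" by (cases b) auto
  have "inv_letter q \<in> set w" using mate[OF w(1,2), of q] eq b by simp
  moreover have "inv_letter q \<noteq> q" by simp
  moreover have "inv_letter q \<noteq> p" "q \<noteq> p"
    using w(1) eq b by auto
  moreover have "inv_letter q \<notin> set b'"
  proof
    assume "inv_letter q \<in> set b'"
    then obtain b1 b2 where "b' = b1 @ inv_letter q # b2" by (meson split_list)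
    then have "w = (a @ [p]) @ q # b1 @ inv_letter q # (b2 @ inv_letter p # c)" "length b1 < n"
      using eq b len by simp_all
    with least[of "length b1"] show False unfolding P_def by blast
  qed
  ultimately have "inv_letter q \<in> set a \<or> inv_letter q \<in> set c"
    using eq b by auto
  then show ?thesis
  proof
    assume "inv_letter q \<in> set a"
    then obtain a1 a2 where "a = a1 @ inv_letter q # a2" by (meson split_list)
    \<comment> \<open>The inverse of q comes before p here, so it serves as the first letter of the
      crossing and p as the second.\<close>
    then have "w = a1 @ inv_letter q # a2 @ p # [] @ inv_letter (inv_letter q) # b' @ inv_letter p # c"
      using eq b by simp
    then show ?thesis using that by blast
  next
    assume "inv_letter q \<in> set c"
    then obtain c1 c2 where "c = c1 @ inv_letter q # c2" by (meson split_list)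
    then have "w = a @ p # [] @ q # b' @ inv_letter p # c1 @ inv_letter q # c2"
      using eq b by simp
    then show ?thesis using that by blast
  qed
qed

section \<open>Normal forms whose length is bounded by the rank\<close>

lemma Rad_weq: "w \<cong>\<^sub>F w' \<Longrightarrow> Rad S w = Rad S w'"
  by (simp add: Rad_def radical_def om_weq)

lemma card_Rad_le: "finite S \<Longrightarrow> card (Rad S w) \<le> 2 ^ card S"
  using card_mono[of "Pow S" "Rad S w"] by (auto simp: Rad_def card_Pow)

text \<open>Distinctness encodes orientability: both signs of each variable occur. The inequality
  says that twice the number of commutators is at most the rank; each split-off commutator uses two
  coordinates of S and two units of rank.\<close>

lemma normal_form_distinct:
  assumes "distinct w" "qlist w" "vars w \<subseteq> S" "finite S"
  shows "\<exists>us. w \<cong>\<^sub>F prodc us \<and> card (Rad S w) * 2 ^ (2 * length us) \<le> 2 ^ card S"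
  using assms
proof (induction "length w" arbitrary: w S rule: less_induct)
  case less
  consider "w = []" | a p b where "w = a @ p # inv_letter p # b"
    | "w \<noteq> []" "\<And>a p b. w \<noteq> a @ p # inv_letter p # b" by blast
  then show ?case
  proof cases
    case 1
    then show ?thesis
      using card_Rad_le[OF less.prems(4), of "[]"] by (intro exI[of _ "[]"]) simp
  next
    case (2 a p b)
    let ?w = "a @ b"
    have "qlist ?w" using qlist_remove[of a p "[]" "inv_letter p" b] less.prems 2 by simp
    then obtain us where "?w \<cong>\<^sub>F prodc us" "card (Rad S ?w) * 2 ^ (2 * length us) \<le> 2 ^ card S"
      using less.hyps[of ?w S] less.prems 2 by auto
    moreover have "w \<cong>\<^sub>F ?w" using weq_cancel 2 by simp
    ultimately show ?thesis using Rad_weq weq_trans by metis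
  next
    case 3
    then obtain a p b q c d e
      where w: "w = a @ p # b @ q # c @ inv_letter p # d @ inv_letter q # e"
      using crossing[OF less.prems(1,2)] by metis
    let ?x = "fst p" and ?y = "fst q" and ?w = "a @ d @ c @ b @ e"
    define g where "g = a @ d @ c @ winv [p] @ winv a"
    define h where "h = a @ d @ winv [q] @ winv b @ winv c @ winv d @ winv a"
    have fp: "?x \<notin> vars a" "?x \<notin> vars (b @ q # c)" "?x \<notin> vars (d @ inv_letter q # e)"
      using qlist_fresh[of a p "b @ q # c" "inv_letter p" "d @ inv_letter q # e"] less.prems(2) w by auto
    have fq: "?y \<notin> vars (a @ p # b)" "?y \<notin> vars (c @ inv_letter p # d)" "?y \<notin> vars e"
      using qlist_fresh[of "a @ p # b" q "c @ inv_letter p # d" "inv_letter q" e] less.prems(2) w by auto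
    have "qlist (a @ (b @ q # c) @ (d @ inv_letter q # e))"
      using qlist_remove[of a p "b @ q # c" "inv_letter p"] less.prems(2) w by simp
    then have "qlist ((a @ b) @ (c @ d) @ e)"
      using qlist_remove[of "a @ b" q "c @ d" "inv_letter q" e] by simp
    then have q': "qlist ?w" by (simp add: qlist_def ac_simps)
    have eq: "w \<cong>\<^sub>F winv g @ winv h @ g @ h @ ?w"
      using commutator_identity[of a "[p]" b "[q]" c d e] by (simp add: w g_def h_def)
    have le: "card (Rad S w) \<le> card (Rad (S - {?x, ?y}) ?w)"
      using less.prems w fp fq
      by (intro Rad_commutator[OF eq]) (auto simp: g_def h_def)
    have vs: "vars ?w \<subseteq> S - {?x, ?y}"
      using less.prems w fp fq by auto
    have dist: "distinct ?w" using less.prems(1) unfolding w by auto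
    have len: "length ?w < length w" by (simp add: w)
    obtain us where us: "?w \<cong>\<^sub>F prodc us"
      "card (Rad (S - {?x, ?y}) ?w) * 2 ^ (2 * length us) \<le> 2 ^ card (S - {?x, ?y})"
      using less.hyps[OF len dist q' vs finite_Diff[OF less.prems(4)]] by blast
    have xy: "?x \<in> S" "?y \<in> S" "?x \<noteq> ?y" using less.prems(3) w fp by auto
    then have cS: "card S = card (S - {?x, ?y}) + 2"
      using less.prems(4) card_Diff_subset[of "{?x, ?y}" S] card_mono[of S "{?x, ?y}"] by auto
    have "w \<cong>\<^sub>F prodc ((g, h) # us)"
      using weq_trans[OF eq] weq_append[OF weq_refl[of "winv g @ winv h @ g @ h"] us(1)] by simp
    moreover have "card (Rad S w) * 2 ^ (2 * length us) \<le> 2 ^ card (S - {?x, ?y})"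
      using mult_le_mono1[OF le, of "2 ^ (2 * length us)"] us(2) by linarith
    then have "card (Rad S w) * 2 ^ (2 * length ((g, h) # us)) \<le> 2 ^ card S"
      by (simp add: cS)
    ultimately show ?thesis by blast
  qed
qed

text \<open>A repeated letter yields a square and lowers the rank. If the remainder has become
  orientable with h commutators, they turn into 2h + 1 squares together with that square, which
  still fits, since the rank of the remainder is at least 2h.\<close>

lemma normal_form_not_distinct:
  assumes "\<not> distinct w" "qlist w" "vars w \<subseteq> S" "finite S"
  shows "\<exists>us. w \<cong>\<^sub>F prods us \<and> card (Rad S w) * 2 ^ length us \<le> 2 ^ card S"
  using assms
proof (induction "length w" arbitrary: w S rule: less_induct)
  case less
  obtain a p b c where w: "w = a @ p # b @ p # c"
    using not_distinct_decomp[OF less.prems(1)] by auto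
  let ?x = "fst p" and ?w = "a @ winv b @ c"
  define u where "u = a @ [p] @ b @ winv a"
  note fresh = qlist_fresh[OF less.prems(2)[unfolded w] refl]
  have "qlist (a @ b @ c)"
    using qlist_remove less.prems(2) w by blast
  then have q': "qlist ?w" by (simp add: qlist_def)
  have eq: "w \<cong>\<^sub>F u @ u @ ?w"
    using square_identity[of a "[p]" b c] by (simp add: w u_def)
  have le: "card (Rad S w) \<le> card (Rad (S - {?x}) ?w)"
    using less.prems w fresh by (intro Rad_square[OF eq]) (auto simp: u_def)
  have vs: "vars ?w \<subseteq> S - {?x}" using less.prems(3) w fresh by auto
  have cS: "card S = Suc (card (S - {?x}))"
    using less.prems(3,4) w by (intro card_Suc_Diff1[symmetric]) auto
  show ?case
  proof (cases "distinct ?w")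
    case True
    obtain us where us: "?w \<cong>\<^sub>F prodc us"
      "card (Rad (S - {?x}) ?w) * 2 ^ (2 * length us) \<le> 2 ^ card (S - {?x})"
      using normal_form_distinct[OF True q' vs] less.prems(4) by auto
    obtain us' where us': "length us' = Suc (2 * length us)" "u @ u @ prodc us \<cong>\<^sub>F prods us'"
      using square_times_commutators by blast
    have "u @ u @ ?w \<cong>\<^sub>F u @ u @ prodc us"
      using weq_append[OF weq_refl[of "u @ u"] us(1)] by simp
    then have "w \<cong>\<^sub>F prods us'"
      using eq us'(2) weq_trans by blast
    moreover have "card (Rad S w) * 2 ^ (2 * length us) \<le> 2 ^ card (S - {?x})"
      using mult_le_mono1[OF le, of "2 ^ (2 * length us)"] us(2) by linarith
    then have "card (Rad S w) * 2 ^ length us' \<le> 2 ^ card S"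
      by (simp add: cS us'(1))
    ultimately show ?thesis by blast
  next
    case False
    obtain us where us: "?w \<cong>\<^sub>F prods us"
      "card (Rad (S - {?x}) ?w) * 2 ^ length us \<le> 2 ^ card (S - {?x})"
      using less.hyps[OF _ False q' vs] less.prems(4) w by auto
    have "u @ u @ ?w \<cong>\<^sub>F u @ u @ prods us"
      using weq_append[OF weq_refl[of "u @ u"] us(1)] by simp
    then have "w \<cong>\<^sub>F prods (u # us)"
      using weq_trans[OF eq] by simp
    moreover have "card (Rad S w) * 2 ^ length us \<le> 2 ^ card (S - {?x})"
      using mult_le_mono1[OF le, of "2 ^ length us"] us(2) by linarith
    then have "card (Rad S w) * 2 ^ length (u # us) \<le> 2 ^ card S"
      by (simp add: cS)
    ultimately show ?thesis by blast
  qed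
qed

lemma om_filter: "x \<notin> v \<Longrightarrow> x \<notin> u \<Longrightarrow> om v u (filter (\<lambda>p. fst p \<noteq> x) w) = om v u w"
proof -
  assume x: "x \<notin> v" "x \<notin> u"
  have "par u (filter (\<lambda>p. fst p \<noteq> x) w) = par u w" for w
    using x by (induction w) auto
  then show ?thesis using x by (induction w) auto
qed

text \<open>If no radical vector contains x, the radical of w embeds into that of the word without
  x, while the ambient dimension falls by one. So the rank falls below r, and with it the length of
  the normal form; the factor 2 in the orientable case counts two units of rank per
  commutator.\<close>

lemma rank_drop:
  assumes w: "qlist w" "x \<in> vars w" and norad: "\<And>v. radical w v \<Longrightarrow> x \<notin> v"
    and r: "2 ^ card (vars w) \<le> card (Rad (vars w) w) * 2 ^ r"
  defines "w0 \<equiv> filter (\<lambda>p. fst p \<noteq> x) w"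
  shows "(distinct w0 \<longrightarrow> (\<exists>us. w0 \<cong>\<^sub>F prodc us \<and> 2 * length us < r)) \<and>
    (\<not> distinct w0 \<longrightarrow> (\<exists>us. w0 \<cong>\<^sub>F prods us \<and> length us < r))"
proof -
  let ?S = "vars w - {x}"
  have "Rad (vars w) w \<subseteq> Rad ?S w0"
  proof
    fix v assume "v \<in> Rad (vars w) w"
    then have v: "v \<subseteq> vars w" "radical w v" "x \<notin> v" using norad by (auto simp: Rad_def)
    have "\<not> om v u w0" for u
    proof -
      have "om v u w0 = om v (u - {x}) w0" by (rule om_cong) (auto simp: w0_def)
      also have "\<dots> = om v (u - {x}) w" unfolding w0_def by (rule om_filter) (use v in auto)
      finally show ?thesis using v(2) by (simp add: radical_def)
    qed
    then show "v \<in> Rad ?S w0" using v by (auto simp: Rad_def radical_def)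
  qed
  then have "card (Rad (vars w) w) \<le> card (Rad ?S w0)" by (simp add: card_mono)
  then have "2 ^ card (vars w) \<le> card (Rad ?S w0) * 2 ^ r"
    using mult_le_mono1[of "card (Rad (vars w) w)" "card (Rad ?S w0)" "2 ^ r"] r by linarith
  moreover have "card (vars w) = Suc (card ?S)" using w(2) by (intro card.remove) auto
  ultimately have lower: "2 * 2 ^ card ?S \<le> card (Rad ?S w0) * 2 ^ r" by simp
  have bound: "m < r" if "card (Rad ?S w0) * 2 ^ m \<le> 2 ^ card ?S" for m
  proof (rule ccontr)
    assume "\<not> m < r"
    then have "(2::nat) ^ r \<le> 2 ^ m" by (simp add: power_increasing)
    then have "card (Rad ?S w0) * 2 ^ r \<le> card (Rad ?S w0) * 2 ^ m" by (rule mult_le_mono2)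
    then have "2 * 2 ^ card ?S \<le> (2::nat) ^ card ?S" using lower that by linarith
    moreover have "(0::nat) < 2 ^ card ?S" by simp
    ultimately show False by linarith
  qed
  have q: "qlist w0" and vs: "vars w0 \<subseteq> ?S" using w(1) by (simp_all add: w0_def qlist_filter)
  show ?thesis
    using normal_form_distinct[OF _ q vs] normal_form_not_distinct[OF _ q vs] bound by fastforce
qed

subsection \<open>Reachable solutions and their descent\<close>

text \<open>The substitution s is the automorphism carrying Q to W, and t witnesses its
  invertibility. Compatibility with \<phi> is asked on \<open>vars Q\<close> only, so \<psi> can be
  changed at variables outside W and the images of \<open>vars Q\<close>.\<close>

definition reach :: "'a letter list \<Rightarrow> ('a \<Rightarrow> 'b letter list) \<Rightarrow> 'a letter list \<Rightarrow> ('a \<Rightarrow> 'b letter list) \<Rightarrow> bool"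
  where "reach Q \<phi> W \<psi> \<longleftrightarrow> qlist W \<and> (\<forall>x. reduced (\<psi> x)) \<and>
    (\<exists>s t. inv_subst s t \<and> ext s Q \<cong>\<^sub>F W \<and> (\<forall>x\<in>vars Q. ext \<psi> (s x) \<cong>\<^sub>F \<phi> x))"

lemma reach_qlist: "reach Q \<phi> W \<psi> \<Longrightarrow> qlist W"
  and reach_reduced: "reach Q \<phi> W \<psi> \<Longrightarrow> reduced (\<psi> x)"
  unfolding reach_def by blast+

lemma reach_refl: "qlist Q \<Longrightarrow> (\<And>x. reduced (\<phi> x)) \<Longrightarrow> reach Q \<phi> Q \<phi>"
  unfolding reach_def by (auto intro!: exI[of _ "\<lambda>x. [(x, True)]"] inv_subst_id simp: ext_id)

lemma reach_step:
  assumes "reach Q \<phi> W \<psi>" "inv_subst s t" "ext s W \<cong>\<^sub>F W'" "qlist W'"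
    "\<And>x. reduced (\<psi>' x)" "\<And>x. ext \<psi>' (s x) \<cong>\<^sub>F \<psi> x"
  shows "reach Q \<phi> W' \<psi>'"
proof -
  obtain s0 t0 where s0: "inv_subst s0 t0" "ext s0 Q \<cong>\<^sub>F W" "\<And>x. x \<in> vars Q \<Longrightarrow> ext \<psi> (s0 x) \<cong>\<^sub>F \<phi> x"
    using assms(1) unfolding reach_def by blast
  have "ext (\<lambda>x. ext s (s0 x)) Q \<cong>\<^sub>F W'"
    using weq_trans[OF ext_weq[OF s0(2), of s] assms(3)] by (simp only: ext_ext)
  moreover have "ext \<psi>' (ext s (s0 x)) \<cong>\<^sub>F \<phi> x" if "x \<in> vars Q" for x
    unfolding ext_ext by (rule weq_trans[OF ext_cong[OF assms(6)] s0(3)[OF that]])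
  ultimately show ?thesis
    unfolding reach_def using inv_subst_comp[OF s0(1) assms(2)] assms(4,5) by blast
qed

lemma reach_fresh:
  assumes "reach Q \<phi> W \<psi>" "infinite (UNIV :: 'a set)"
  shows "\<exists>z::'a. z \<notin> vars W \<and> (\<forall>l. reach Q \<phi> W (\<psi>(z := [l])))"
proof -
  obtain s t where st: "inv_subst s t" "ext s Q \<cong>\<^sub>F W" "\<And>x. x \<in> vars Q \<Longrightarrow> ext \<psi> (s x) \<cong>\<^sub>F \<phi> x"
    and q: "qlist W" "\<And>x. reduced (\<psi> x)"
    using assms(1) unfolding reach_def by blast
  have "finite (vars W \<union> (\<Union>x\<in>vars Q. vars (s x)))" by simp
  then obtain z where z: "z \<notin> vars W \<union> (\<Union>x\<in>vars Q. vars (s x))"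
    using ex_new_if_finite[OF assms(2)] by blast
  have "ext (\<psi>(z := l)) (s x) = ext \<psi> (s x)" if "x \<in> vars Q" for x l
    by (rule ext_cong_eq) (use z that in auto)
  then have "\<forall>x\<in>vars Q. ext (\<psi>(z := [l])) (s x) \<cong>\<^sub>F \<phi> x" for l
    using st(3) by simp
  moreover have "\<forall>x. reduced ((\<psi>(z := [l])) x)" for l
    using q(2) by (simp add: reduced_def)
  ultimately have "reach Q \<phi> W (\<psi>(z := [l]))" for l
    unfolding reach_def using q(1) st(1,2) by blast
  with z show ?thesis by auto
qed

lemma reach_weq: "reach Q \<phi> W \<psi> \<Longrightarrow> ext \<psi> W \<cong>\<^sub>F ext \<phi> Q"
proof -
  assume "reach Q \<phi> W \<psi>"
  then obtain s where s: "ext s Q \<cong>\<^sub>F W" "\<And>x. x \<in> vars Q \<Longrightarrow> ext \<psi> (s x) \<cong>\<^sub>F \<phi> x"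
    unfolding reach_def by blast
  have "ext \<psi> (ext s Q) \<cong>\<^sub>F ext \<phi> Q"
    unfolding ext_ext by (rule ext_cong) (rule s)
  with ext_weq[OF s(1), of \<psi>] show ?thesis using weq_trans weq_sym by blast
qed

text \<open>Splitting off a cancelling letter shortens images by two letters, saving 4, and costs 3
  for a fresh variable with a one-letter image. The summand 1 makes the deletion of a variable
  strict, even when its image is trivial or passes into another one.\<close>

definition mu :: "'a letter list \<Rightarrow> ('a \<Rightarrow> 'b letter list) \<Rightarrow> nat" where
  "mu W \<psi> = (\<Sum>x\<in>vars W. 2 * length (\<psi> x) + 1)"

lemma mu_less: "vars W' \<subset> vars W \<Longrightarrow> mu W' \<psi> < mu W \<psi>"
proof -
  assume "vars W' \<subset> vars W"
  then obtain x where "x \<in> vars W - vars W'" "vars W' \<subseteq> vars W" by blast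
  then show ?thesis
    unfolding mu_def by (intro sum_strict_mono2[of _ _ x]) auto
qed

lemma ext_upd [simp]: "ext (upd p L f) (p # u) = L @ ext (upd p L f) u"
  by (simp add: upd_def)

lemma ext_upd_inv [simp]: "ext (upd p L f) (inv_letter p # u) = winv L @ ext (upd p L f) u"
  by (simp add: upd_def)

lemma upd_other [simp]: "x \<noteq> fst p \<Longrightarrow> upd p L f x = f x"
  by (simp add: upd_def)

lemma length_upd [simp]: "length (upd p L f (fst p)) = length L"
  by (simp add: upd_def)

lemma reduced_winv: "reduced w \<Longrightarrow> reduced (winv w)"
  unfolding winv_def by (rule reduced_inverse)

lemma reduced_upd: "reduced L \<Longrightarrow> (\<And>x. reduced (f x)) \<Longrightarrow> reduced (upd p L f x)"
  by (cases "x = fst p") (auto simp: upd_def reduced_winv)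

lemma upd_target: "ext g L \<cong>\<^sub>F ext h [p] \<Longrightarrow> ext g (upd p L f (fst p)) \<cong>\<^sub>F h (fst p)"
  using weq_winv[of "ext g L" "ext h [p]"] by (cases "snd p") (simp_all add: upd_def)

lemma length_ext_letter: "length (ext f [p]) = length (f (fst p))"
  by simp

lemma reduced_append: "reduced (u @ v) \<longleftrightarrow>
    reduced u \<and> reduced v \<and> (u = [] \<or> v = [] \<or> hd v \<noteq> inv_letter (last u))"
  unfolding reduced_def successively_append_iff by blast

abbreviation idf :: "'a \<Rightarrow> 'a letter list" where "idf \<equiv> \<lambda>x. [(x, True)]"

section \<open>Moves that lower the weight\<close>

lemma reduce_inverse_pair:
  assumes "reach Q \<phi> W \<psi>" "W = a @ p # inv_letter p # b"
  shows "\<exists>W' \<psi>'. reach Q \<phi> W' \<psi>' \<and> mu W' \<psi>' < mu W \<psi>"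
proof -
  have q: "qlist W" "\<And>x. reduced (\<psi> x)" using reach_qlist[OF assms(1)] reach_reduced[OF assms(1)] by auto
  have q': "qlist (a @ b)" using qlist_remove[of a p "[]" "inv_letter p" b] q assms(2) by simp
  have "reach Q \<phi> (a @ b) \<psi>"
  proof (rule reach_step[OF assms(1) inv_subst_id _ q' q(2)])
    show "ext (\<lambda>x. [(x, True)]) W \<cong>\<^sub>F a @ b" unfolding ext_id assms(2) by (rule weq_cancel)
  qed simp
  moreover have "vars (a @ b) \<subset> vars W"
    using qlist_fresh[of a p "[]" "inv_letter p" b] q(1) unfolding assms(2) by auto
  ultimately show ?thesis by (intro exI conjI) (assumption, rule mu_less)
qed

text \<open>The contraction multiplies edges by powers of x only. These have trivial image, so
  \<psi> itself solves the contracted equation.\<close>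

lemma reduce_trivial_letter:
  assumes "reach Q \<phi> W \<psi>" "x \<in> vars W" "\<psi> x = []" "radical W v" "x \<in> v"
  shows "\<exists>W' \<psi>'. reach Q \<phi> W' \<psi>' \<and> mu W' \<psi>' < mu W \<psi>"
proof -
  have q: "qlist W" "\<And>x. reduced (\<psi> x)" using reach_qlist[OF assms(1)] reach_reduced[OF assms(1)] by auto
  obtain pot where pot: "potential W v pot" using radical_potential[OF q(1) assms(4)] by blast
  define t where "t = (x, \<not> pot x)"
  have "ext \<psi> (contr v pot x t y) = \<psi> y" for y
    using assms(3) by (auto simp: contr_def pw_def t_def)
  then have "reach Q \<phi> (filter (\<lambda>p. fst p \<noteq> x) W) \<psi>"
    by (intro reach_step[OF assms(1) inv_subst_contr contraction[OF q(1) pot assms(5) t_def]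
        qlist_filter[OF q(1)] q(2)]) (auto simp: t_def)
  moreover have "vars (filter (\<lambda>p. fst p \<noteq> x) W) \<subset> vars W" using assms(2) by auto
  ultimately show ?thesis by (intro exI conjI) (assumption, rule mu_less)
qed

text \<open>The potential is 1 only at the vertex between p and q. Contracting q replaces p by p
  q^-1, which the new image of p, the product of the images of p and q, compensates. The total
  length does not grow, and one variable disappears.\<close>

lemma reduce_redundant_pair:
  assumes "reach Q \<phi> W \<psi>" "fst p \<in> vars W" "fst q \<in> vars W" "fst p \<noteq> fst q"
    and pot: "potential W {fst p, fst q} (\<lambda>y. if y = fst p then \<not> snd p else y = fst q \<and> snd q)"
      (is "potential W ?v ?pot")
  shows "\<exists>W' \<psi>'. reach Q \<phi> W' \<psi>' \<and> mu W' \<psi>' < mu W \<psi>"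
proof -
  have q: "qlist W" "\<And>x. reduced (\<psi> x)" using reach_qlist[OF assms(1)] reach_reduced[OF assms(1)] by auto
  let ?x = "fst q" and ?t = "inv_letter q"
  let ?s = "contr ?v ?pot ?x ?t" and ?W = "filter (\<lambda>p. fst p \<noteq> ?x) W"
  define \<psi>' where "\<psi>' = upd p (reduce (ext \<psi> [p, q])) \<psi>"
  have t: "?t = (?x, \<not> ?pot ?x)" using assms(4) by (auto simp: inv_letter_def)
  have \<psi>'p: "ext \<psi>' [p] \<cong>\<^sub>F ext \<psi> [p] @ ext \<psi> [q]" "ext \<psi>' [q] = ext \<psi> [q]"
    using assms(4) unfolding \<psi>'_def ext_upd by auto
  have pq: "ext \<psi>' [p, inv_letter q] \<cong>\<^sub>F ext \<psi> [p]"
  proof -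
    have "ext \<psi>' [p, inv_letter q] = ext \<psi>' [p] @ winv (ext \<psi>' [q])" by auto
    also have "\<dots> \<cong>\<^sub>F (ext \<psi> [p] @ ext \<psi> [q]) @ winv (ext \<psi> [q])"
      unfolding \<psi>'p(2) by (intro weq_append \<psi>'p weq_refl)
    also have "\<dots> \<cong>\<^sub>F ext \<psi> [p]"
      using winv_cancel(1)[of "ext \<psi> [p]" "ext \<psi> [q]" "[]"] by simp
    finally show ?thesis .
  qed
  have "contr ?v ?pot ?x ?t (fst p) = upd p [p, inv_letter q] idf (fst p)"
    using assms(4) by (cases p) (auto simp: contr_def upd_def pw_def inv_letter_def)
  then have "ext \<psi>' (?s y) \<cong>\<^sub>F \<psi> y" for y
    using upd_target[OF pq, of idf] by (cases "y = fst p") (auto simp: \<psi>'_def contr_def pw_def)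
  moreover have "reduced (\<psi>' y)" for y
    unfolding \<psi>'_def by (intro reduced_upd q) simp
  ultimately have "reach Q \<phi> ?W \<psi>'"
    using contraction[OF q(1) pot _ t]
    by (intro reach_step[OF assms(1) inv_subst_contr _ qlist_filter[OF q(1)]]) auto
  moreover have "mu ?W \<psi>' < mu W \<psi>"
  proof -
    let ?R = "vars W - {?x} - {fst p}"
    have "mu ?W \<psi>' = 2 * length (\<psi>' (fst p)) + 1 + (\<Sum>x\<in>?R. 2 * length (\<psi>' x) + 1)"
      unfolding mu_def vars_filter using assms(2,4) by (intro sum.remove) auto
    moreover have "(\<Sum>x\<in>?R. 2 * length (\<psi>' x) + 1) = (\<Sum>x\<in>?R. 2 * length (\<psi> x) + 1)"
      by (intro sum.cong) (auto simp: \<psi>'_def)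
    moreover have "mu W \<psi> = 2 * length (\<psi> ?x) + 1 + (\<Sum>x\<in>vars W - {?x}. 2 * length (\<psi> x) + 1)"
      unfolding mu_def using assms(3) by (intro sum.remove) auto
    moreover have "(\<Sum>x\<in>vars W - {?x}. 2 * length (\<psi> x) + 1) =
        2 * length (\<psi> (fst p)) + 1 + (\<Sum>x\<in>?R. 2 * length (\<psi> x) + 1)"
      using assms(2,4) by (intro sum.remove) auto
    moreover have "length (\<psi>' (fst p)) \<le> length (\<psi> (fst p)) + length (\<psi> (fst q))"
    proof -
      have "length (ext \<psi> [p, q]) = length (\<psi> (fst p)) + length (\<psi> (fst q))" by simp
      then show ?thesis
        using length_reduce[of "ext \<psi> [p, q]"] by (simp only: \<psi>'_def length_upd)
    qed
    ultimately show ?thesis by linarith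
  qed
  ultimately show ?thesis by blast
qed

text \<open>The fresh z takes the cancelling letter l as its image, by the substitution of p z^-1
  for p and z q for q. At the chosen place z cancels; it survives once at the other occurrence of p
  and once at that of q, so the word stays quadratic.\<close>

lemma reduce_cancelling_pair:
  fixes W :: "'a letter list"
  assumes "reach Q \<phi> W \<psi>" "infinite (UNIV :: 'a set)" and W: "W = a @ p # q # b" "fst p \<noteq> fst q"
    and c: "ext \<psi> [p] = P @ [inv_letter l]" "ext \<psi> [q] = l # R"
  shows "\<exists>W' \<psi>'. reach Q \<phi> W' \<psi>' \<and> mu W' \<psi>' < mu W \<psi>"
proof -
  have q: "qlist W" "\<And>x. reduced (\<psi> x)" using reach_qlist[OF assms(1)] reach_reduced[OF assms(1)] by auto
  obtain z where z: "z \<notin> vars W" and reach1: "reach Q \<phi> W (\<psi>(z := [l]))"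
    using reach_fresh[OF assms(1,2)] by blast
  \<comment> \<open>The flag d is the sign of z, so that \<open>s False\<close> is the inverse of
    \<open>s True\<close>.\<close>
  define s where "s d = upd p [p, (z, \<not> d)] (upd q [(z, d), q] idf)" for d
  define \<psi>' where "\<psi>' = upd p P (upd q R (\<psi>(z := [l])))"
  define W' where "W' = ext (s True) a @ p # q # ext (s True) b"
  have zpq: "z \<noteq> fst p" "z \<noteq> fst q" "z \<notin> vars a" "z \<notin> vars b" using z W by auto
  have split: "ext f [m, n] = ext f [m] @ ext f [n]" for m n and f :: "'a \<Rightarrow> 'c letter list"
    by simp
  have s_letters: "ext (s d) [p] = [p, (z, \<not> d)]" "ext (s d) [q] = [(z, d), q]" "ext (s d) [(z, e)] = [(z, e)]"
    for d e
  proof -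
    show "ext (s d) [p] = [p, (z, \<not> d)]" by (simp add: s_def del: ext_simps(3))
    have "ext (upd p L f) [q] = ext f [q]" for L and f :: "'a \<Rightarrow> 'a letter list"
      using W(2) by simp
    then have "ext (s d) [q] = ext (upd q [(z, d), q] idf) [q]" by (simp only: s_def)
    also have "\<dots> = [(z, d), q]" by (simp del: ext_simps(3))
    finally show "ext (s d) [q] = [(z, d), q]" .
    show "ext (s d) [(z, e)] = [(z, e)]" using zpq by (simp add: s_def inv_letter_def)
  qed
  have \<psi>'_letters: "ext \<psi>' [p] = P" "ext \<psi>' [q] = R" "ext \<psi>' [(z, True)] = [l]"
      "ext \<psi>' [(z, False)] = [inv_letter l]"
    using W(2) zpq by (auto simp: \<psi>'_def upd_def)
  have idl: "ext idf [m] = [m]" for m :: "'a letter" by (simp only: ext_id)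
  have two: "ext g (s d y) \<cong>\<^sub>F h y"
    if "ext g [p, (z, \<not> d)] \<cong>\<^sub>F ext h [p]" "ext g [(z, d), q] \<cong>\<^sub>F ext h [q]"
      "\<And>y. y \<noteq> fst p \<Longrightarrow> y \<noteq> fst q \<Longrightarrow> g y \<cong>\<^sub>F h y"
    for g :: "'a \<Rightarrow> 'c letter list" and h d y
    using upd_target[OF that(1)] upd_target[OF that(2)] that(3)[of y] W(2)
    by (cases "y = fst p"; cases "y = fst q") (auto simp: s_def)
  have inv: "ext (s (\<not> d)) (s d y) \<cong>\<^sub>F idf y" for d y
  proof (rule two)
    show "ext (s (\<not> d)) [p, (z, \<not> d)] \<cong>\<^sub>F ext idf [p]"
      unfolding split s_letters idl using weq_cancel[of "[p]" "(z, d)" "[]"] by (simp add: inv_letter_def)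
    show "ext (s (\<not> d)) [(z, d), q] \<cong>\<^sub>F ext idf [q]"
      unfolding split s_letters idl using weq_cancel[of "[]" "(z, d)" "[q]"] by (simp add: inv_letter_def)
  qed (simp add: s_def)
  have "inv_subst (s True) (s False)"
    using inv[of True] inv[of False] by (simp add: inv_subst_def)
  moreover have "ext (s True) W \<cong>\<^sub>F W'"
  proof -
    have "ext (s True) W = (ext (s True) a @ [p]) @ (z, False) # inv_letter (z, False) # (q # ext (s True) b)"
      using s_letters(1,2)[of True] by (simp add: W(1) inv_letter_def)
    with weq_cancel show ?thesis by (metis W'_def append.assoc append_Cons append_Nil)
  qed
  moreover have "qlist W'"
  proof -
    have cnt: "cnt (ext (s True) u) y = (if y = z then cnt u (fst p) + cnt u (fst q) else cnt u y)"
      if "z \<notin> vars u" for u y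
      using that
    proof (induction u)
      case (Cons m u)
      have "cnt (ext (s True) [m]) y = (if y = z then cnt [m] (fst p) + cnt [m] (fst q) else cnt [m] y)"
        using zpq W(2) Cons.prems by (auto simp: s_def upd_def)
      moreover have "ext (s True) (m # u) = ext (s True) [m] @ ext (s True) u" by simp
      ultimately show ?case using Cons by simp
    qed simp
    have two: "cnt W x = 0 \<or> cnt W x = 2" for x using q(1) by (simp add: qlist_def)
    show ?thesis
      unfolding qlist_def
    proof
      fix x
      show "cnt W' x = 0 \<or> cnt W' x = 2"
        using two[of "fst p"] two[of "fst q"] two[of x] zpq W(2) by (auto simp: W'_def W(1) cnt)
    qed
  qed
  moreover have "reduced (\<psi>' x)" for x
  proof -
    have "reduced (ext \<psi> [p])" "reduced (ext \<psi> [q])" using q(2) reduced_winv by auto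
    then have "reduced P" "reduced R" unfolding c by (auto simp: reduced_append dest: reduced_Cons)
    then show ?thesis unfolding \<psi>'_def using q(2) by (intro reduced_upd) (auto simp: reduced_def)
  qed
  moreover have "ext \<psi>' (s True x) \<cong>\<^sub>F (\<psi>(z := [l])) x" for x
  proof (rule two)
    have o: "ext (\<psi>(z := [l])) [p] = P @ [inv_letter l]" "ext (\<psi>(z := [l])) [q] = l # R"
      using c zpq by auto
    show "ext \<psi>' [p, (z, \<not> True)] \<cong>\<^sub>F ext (\<psi>(z := [l])) [p]"
      using \<psi>'_letters by (simp only: split o not_True_eq_False weq_refl)
    show "ext \<psi>' [(z, True), q] \<cong>\<^sub>F ext (\<psi>(z := [l])) [q]"
      using \<psi>'_letters by (simp only: split o append_Cons append_Nil weq_refl)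
  qed (simp add: \<psi>'_def)
  ultimately have "reach Q \<phi> W' \<psi>'"
    using reach_step[OF reach1] by blast
  moreover have "mu W' \<psi>' < mu W \<psi>"
  proof -
    have "vars (ext (s True) u) \<subseteq> insert z (vars u)" for u
    proof (induction u)
      case (Cons m u)
      have "vars (ext (s True) [m]) \<subseteq> {z, fst m}"
        by (auto simp: s_def upd_def)
      moreover have "ext (s True) (m # u) = ext (s True) [m] @ ext (s True) u" by simp
      ultimately show ?case using Cons by (simp del: ext_simps(3)) blast
    qed simp
    then have "vars W' \<subseteq> insert z (vars W)" unfolding W'_def W by fastforce
    then have "mu W' \<psi>' \<le> (\<Sum>x\<in>insert z (vars W). 2 * length (\<psi>' x) + 1)"
      unfolding mu_def by (intro sum_mono2) auto
    also have "\<dots> = 2 * length (\<psi>' z) + 1 + (\<Sum>x\<in>vars W. 2 * length (\<psi>' x) + 1)"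
      using z by (simp del: sum.insert_remove)
    finally have 1: "mu W' \<psi>' \<le> 3 + (\<Sum>x\<in>vars W. 2 * length (\<psi>' x) + 1)"
      using zpq by (simp add: \<psi>'_def)
    let ?R = "vars W - {fst p} - {fst q}"
    have expand: "(\<Sum>x\<in>vars W. 2 * length (f x) + 1) =
        2 * length (f (fst p)) + 1 + (2 * length (f (fst q)) + 1 + (\<Sum>x\<in>?R. 2 * length (f x) + 1))"
      for f :: "'a \<Rightarrow> 'b letter list"
    proof -
      have "(\<Sum>x\<in>vars W. 2 * length (f x) + 1) =
          2 * length (f (fst p)) + 1 + (\<Sum>x\<in>vars W - {fst p}. 2 * length (f x) + 1)"
        unfolding W by (intro sum.remove) auto
      also have "(\<Sum>x\<in>vars W - {fst p}. 2 * length (f x) + 1) =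
          2 * length (f (fst q)) + 1 + (\<Sum>x\<in>?R. 2 * length (f x) + 1)"
        using W(2) unfolding W(1) by (intro sum.remove) auto
      finally show ?thesis .
    qed
    have "(\<Sum>x\<in>?R. 2 * length (\<psi>' x) + 1) = (\<Sum>x\<in>?R. 2 * length (\<psi> x) + 1)"
      using z by (intro sum.cong) (auto simp: \<psi>'_def)
    moreover have "length (\<psi> (fst p)) = Suc (length (\<psi>' (fst p)))"
      "length (\<psi> (fst q)) = Suc (length (\<psi>' (fst q)))"
      using arg_cong[OF c(1), of length] arg_cong[OF c(2), of length] \<psi>'_letters(1,2)[THEN arg_cong, of length]
      unfolding length_ext_letter by simp_all
    ultimately show ?thesis
      using 1 unfolding expand mu_def[of W \<psi>] by linarith
  qed
  ultimately show ?thesis by blast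
qed

text \<open>When the two letters coincide, l is a conjugating letter at both ends of the image of p.
  Conjugating p by z strips both ends at once, and z cancels between the two copies of p.\<close>

lemma reduce_cancelling_square:
  fixes W :: "'a letter list"
  assumes "reach Q \<phi> W \<psi>" "infinite (UNIV :: 'a set)" and W: "W = a @ p # p # b"
    and c: "ext \<psi> [p] = P @ [inv_letter l]" "ext \<psi> [p] = l # R"
  shows "\<exists>W' \<psi>'. reach Q \<phi> W' \<psi>' \<and> mu W' \<psi>' < mu W \<psi>"
proof -
  have q: "qlist W" "\<And>x. reduced (\<psi> x)" using reach_qlist[OF assms(1)] reach_reduced[OF assms(1)] by auto
  obtain z where z: "z \<notin> vars W" and reach1: "reach Q \<phi> W (\<psi>(z := [l]))"
    using reach_fresh[OF assms(1,2)] by blast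
  \<comment> \<open>The prefix P cannot be empty, as that would make l equal to its own
    inverse.\<close>
  obtain T where T: "ext \<psi> [p] = l # T @ [inv_letter l]"
    using c by (cases P) auto
  define s where "s d = upd p [(z, d), p, (z, \<not> d)] idf" for d
  define \<psi>' where "\<psi>' = upd p T (\<psi>(z := [l]))"
  define W' where "W' = a @ [(z, True), p, p, (z, False)] @ b"
  have zp: "z \<noteq> fst p" "z \<notin> vars a" "z \<notin> vars b" using z W by auto
  have pab: "fst p \<notin> vars a" "fst p \<notin> vars b"
    using qlist_fresh[of a p "[]" p b] q(1) W by auto
  have split: "ext f [k, m, n] = ext f [k] @ ext f [m] @ ext f [n]" for k m n and f :: "'a \<Rightarrow> 'c letter list"
    by simp
  have s_letters: "ext (s d) [p] = [(z, d), p, (z, \<not> d)]" "ext (s d) [(z, e)] = [(z, e)]" for d e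
  proof -
    show "ext (s d) [p] = [(z, d), p, (z, \<not> d)]" by (simp add: s_def del: ext_simps(3))
    show "ext (s d) [(z, e)] = [(z, e)]" using zp by (simp add: s_def inv_letter_def)
  qed
  have \<psi>'_letters: "ext \<psi>' [p] = T" "ext \<psi>' [(z, True)] = [l]" "ext \<psi>' [(z, False)] = [inv_letter l]"
    using zp by (auto simp: \<psi>'_def upd_def)
  have idl: "ext idf [m] = [m]" for m :: "'a letter" by (simp only: ext_id)
  have one: "ext g (s d y) \<cong>\<^sub>F h y"
    if "ext g [(z, d), p, (z, \<not> d)] \<cong>\<^sub>F ext h [p]" "\<And>y. y \<noteq> fst p \<Longrightarrow> g y \<cong>\<^sub>F h y"
    for g :: "'a \<Rightarrow> 'c letter list" and h d y
    using upd_target[OF that(1)] that(2)[of y] by (cases "y = fst p") (auto simp: s_def)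
  have inv: "ext (s (\<not> d)) (s d y) \<cong>\<^sub>F idf y" for d y
  proof (rule one)
    show "ext (s (\<not> d)) [(z, d), p, (z, \<not> d)] \<cong>\<^sub>F ext idf [p]"
      unfolding split s_letters idl
      using weq_trans[OF weq_cancel[of "[]" "(z, d)" "[p, (z, d), (z, \<not> d)]"]]
        weq_cancel[of "[p]" "(z, d)" "[]"] by (simp add: inv_letter_def)
  qed (simp add: s_def)
  have "inv_subst (s True) (s False)"
    using inv[of True] inv[of False] by (simp add: inv_subst_def)
  moreover have "ext (s True) W \<cong>\<^sub>F W'"
  proof -
    have unchanged: "ext (s True) u = u" if "fst p \<notin> vars u" for u
    proof -
      have "ext (s True) u = ext idf u"
        by (rule ext_cong_eq) (use that in \<open>auto simp: s_def upd_def\<close>)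
      then show ?thesis by (simp only: ext_id)
    qed
    have "ext (s True) W = (a @ [(z, True), p]) @ (z, False) # inv_letter (z, False) # ([p, (z, False)] @ b)"
      using s_letters(1)[of True] unchanged[OF pab(1)] unchanged[OF pab(2)] by (simp add: W inv_letter_def)
    with weq_cancel show ?thesis by (metis W'_def append.assoc append_Cons append_Nil)
  qed
  moreover have "qlist W'"
  proof -
    have two: "cnt W x = 0 \<or> cnt W x = 2" for x using q(1) by (simp add: qlist_def)
    show ?thesis
      unfolding qlist_def
    proof
      fix x
      show "cnt W' x = 0 \<or> cnt W' x = 2"
        using two[of "fst p"] two[of x] zp by (auto simp: W'_def W)
    qed
  qed
  moreover have "reduced (\<psi>' x)" for x
  proof -
    have "reduced (ext \<psi> [p])" using q(2) reduced_winv by auto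
    then have "reduced T" unfolding T using reduced_Cons reduced_append by blast
    then show ?thesis unfolding \<psi>'_def using q(2) by (intro reduced_upd) (auto simp: reduced_def)
  qed
  moreover have "ext \<psi>' (s True x) \<cong>\<^sub>F (\<psi>(z := [l])) x" for x
  proof (rule one)
    have o: "ext (\<psi>(z := [l])) [p] = l # T @ [inv_letter l]"
      using T zp by auto
    show "ext \<psi>' [(z, True), p, (z, \<not> True)] \<cong>\<^sub>F ext (\<psi>(z := [l])) [p]"
      using \<psi>'_letters by (simp only: split o not_True_eq_False append_Cons append_Nil weq_refl)
  qed (simp add: \<psi>'_def)
  ultimately have "reach Q \<phi> W' \<psi>'"
    using reach_step[OF reach1] by blast
  moreover have "mu W' \<psi>' < mu W \<psi>"
  proof -
    have "vars W' = insert z (vars W)" unfolding W'_def W by auto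
    then have "mu W' \<psi>' = (\<Sum>x\<in>insert z (vars W). 2 * length (\<psi>' x) + 1)"
      unfolding mu_def by simp
    also have "\<dots> = 2 * length (\<psi>' z) + 1 + (\<Sum>x\<in>vars W. 2 * length (\<psi>' x) + 1)"
      using z by (simp del: sum.insert_remove)
    finally have 1: "mu W' \<psi>' = 3 + (\<Sum>x\<in>vars W. 2 * length (\<psi>' x) + 1)"
      using zp by (simp add: \<psi>'_def)
    let ?R = "vars W - {fst p}"
    have expand: "(\<Sum>x\<in>vars W. 2 * length (f x) + 1) =
        2 * length (f (fst p)) + 1 + (\<Sum>x\<in>?R. 2 * length (f x) + 1)"
      for f :: "'a \<Rightarrow> 'b letter list"
      unfolding W by (intro sum.remove) auto
    have "(\<Sum>x\<in>?R. 2 * length (\<psi>' x) + 1) = (\<Sum>x\<in>?R. 2 * length (\<psi> x) + 1)"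
      using z by (intro sum.cong) (auto simp: \<psi>'_def)
    moreover have "length (\<psi> (fst p)) = length (\<psi>' (fst p)) + 2"
      using arg_cong[OF T, of length] \<psi>'_letters(1)[THEN arg_cong, of length]
      unfolding length_ext_letter by simp
    ultimately show ?thesis
      using 1 unfolding expand mu_def[of W \<psi>] by linarith
  qed
  ultimately show ?thesis by blast
qed

text \<open>The assumption \<open>triv\<close> is all that genus has to supply: a variable with
  trivial image always lies on a cut, hence can be contracted.\<close>

theorem descent:
  fixes Q :: "'a letter list" and \<phi> :: "'a \<Rightarrow> 'b letter list"
  assumes inf: "infinite (UNIV :: 'a set)" and Q: "qlist Q" "\<And>x. reduced (\<phi> x)"
    and triv: "\<And>W \<psi> x. reach Q \<phi> W \<psi> \<Longrightarrow> x \<in> vars W \<Longrightarrow> \<psi> x = [] \<Longrightarrow> \<exists>v. radical W v \<and> x \<in> v"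
  obtains W \<psi> where "reach Q \<phi> W \<psi>" "\<And>x. x \<in> vars W \<Longrightarrow> \<psi> x \<noteq> []" "reduced W" "reduced (ext \<psi> W)"
    "\<And>p q. fst p \<in> vars W \<Longrightarrow> fst q \<in> vars W \<Longrightarrow> fst p \<noteq> fst q \<Longrightarrow>
      \<not> potential W {fst p, fst q} (\<lambda>y. if y = fst p then \<not> snd p else y = fst q \<and> snd q)"
proof -
  define R where "R n \<longleftrightarrow> (\<exists>W \<psi>. reach Q \<phi> W \<psi> \<and> mu W \<psi> = n)" for n
  have "\<exists>n. R n" using reach_refl[of Q \<phi>] Q unfolding R_def by blast
  then obtain n where n: "R n" "\<And>m. m < n \<Longrightarrow> \<not> R m" using exists_least_iff[of R] by blast
  then obtain W \<psi> where W: "reach Q \<phi> W \<psi>" and least: "\<not> (\<exists>W' \<psi>'. reach Q \<phi> W' \<psi>' \<and> mu W' \<psi>' < mu W \<psi>)"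
    unfolding R_def by blast
  have red\<psi>: "reduced (\<psi> x)" for x using reach_reduced[OF W] .
  have nontriv: "\<psi> x \<noteq> []" if "x \<in> vars W" for x
    using reduce_trivial_letter[OF W that] triv[OF W that] least by blast
  have noinv: "q \<noteq> inv_letter p" if "W = a @ p # q # b" for a p q b
    using reduce_inverse_pair[OF W] that least by blast
  then have redW: "reduced W"
    unfolding reduced_def successively_conv_nth
    by (metis id_take_nth_drop Cons_nth_drop_Suc Suc_lessD)
  have nocancel: "hd (ext \<psi> [q]) \<noteq> inv_letter (last (ext \<psi> [p]))" if w: "W = a @ p # q # b" for a p q b
  proof
    assume h: "hd (ext \<psi> [q]) = inv_letter (last (ext \<psi> [p]))"
    have ne: "ext \<psi> [p] \<noteq> []" "ext \<psi> [q] \<noteq> []"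
      using nontriv w length_ext_letter by (metis in_set_conv_decomp length_0_conv vars_def imageI
        append_Cons append_Nil append.assoc)+
    let ?l = "hd (ext \<psi> [q])"
    have c: "ext \<psi> [p] = butlast (ext \<psi> [p]) @ [inv_letter ?l]" "ext \<psi> [q] = ?l # tl (ext \<psi> [q])"
      using ne h append_butlast_last_id by (metis inv_letter_inv_letter, metis list.collapse)
    show False
    proof (cases "fst p = fst q")
      case True
      then have "p = q" using noinv[OF w] by (auto simp: inv_letter_def prod_eq_iff)
      then show False using reduce_cancelling_square[OF W inf _ c(1)] c w least by metis
    next
      case False
      then show False using reduce_cancelling_pair[OF W inf w False c] least by blast
    qed
  qed
  \<comment> \<open>As no image is empty, cancellation could start only between the images of
    neighbouring letters, which \<open>nocancel\<close> excludes.\<close>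
  have "reduced (ext \<psi> w)" if "W = a @ w" for a w
    using that
  proof (induction w arbitrary: a)
    case (Cons p w)
    have IH: "reduced (ext \<psi> w)" using Cons.IH[of "a @ [p]"] Cons.prems by simp
    have p: "reduced (ext \<psi> [p])" using red\<psi> reduced_winv by auto
    have eq: "ext \<psi> (p # w) = ext \<psi> [p] @ ext \<psi> w" by simp
    show ?case
    proof (cases w)
      case Nil
      with p show ?thesis by simp
    next
      case (Cons q w')
      have "ext \<psi> [q] \<noteq> []"
        using nontriv[of "fst q"] Cons Cons.prems length_ext_letter[of \<psi> q] by auto
      then have "hd (ext \<psi> w) = hd (ext \<psi> [q])" using Cons by simp
      with nocancel[of a p q w'] Cons Cons.prems p IH show ?thesis
        unfolding eq reduced_append by metis
    qed
  qed simp
  from this[of "[]" W] have "reduced (ext \<psi> W)" by simp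
  moreover have "\<not> potential W {fst p, fst q} (\<lambda>y. if y = fst p then \<not> snd p else y = fst q \<and> snd q)"
    if "fst p \<in> vars W" "fst q \<in> vars W" "fst p \<noteq> fst q" for p q
    using reduce_redundant_pair[OF W that] least by blast
  ultimately show ?thesis using that W nontriv redW by blast
qed

subsection \<open>Genus in free groups\<close>

lemma free_group_simps [simp]:
  "w \<in> carrier free_group \<longleftrightarrow> reduced w" "u \<otimes>\<^bsub>free_group\<^esub> v = reduce (u @ v)" "\<one>\<^bsub>free_group\<^esub> = []"
  by (simp_all add: free_group_def)

lemma inv_free_group [simp]: "reduced w \<Longrightarrow> inv\<^bsub>free_group\<^esub> w = winv w"
  using weq_winv_left[of w]
  by (intro group.inv_equality[OF group_free_group]) (auto simp: reduced_winv weq_def reduce_def)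

lemma weq_reduced: "u \<cong>\<^sub>F v \<Longrightarrow> reduced u \<Longrightarrow> reduced v \<Longrightarrow> u = v"
  by (simp add: weq_def reduce_reduced)

lemma list_prod_free_group: "list_prod free_group us = reduce (concat us)"
proof (induction us)
  case (Cons u us)
  have "reduce (u @ reduce (concat us)) = reduce (u @ concat us)"
    using weq_append[OF weq_refl weq_reduce] by (simp add: weq_def)
  with Cons show ?case by (simp add: list_prod_def)
qed (simp add: list_prod_def reduce_def)

lemma commutator_free_group:
  assumes "reduced a" "reduced b"
  shows "commutator free_group a b = reduce (winv a @ winv b @ a @ b)"
proof -
  have "reduce (reduce (reduce (winv a @ winv b) @ a) @ b) \<cong>\<^sub>F ((winv a @ winv b) @ a) @ b"
    by (intro weq_trans[OF weq_reduce] weq_append weq_refl weq_reduce)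
  then show ?thesis using assms by (simp add: commutator_def weq_def reduce_reduced)
qed

lemma weq_concat_map: "(\<And>x. x \<in> set xs \<Longrightarrow> f x \<cong>\<^sub>F g x) \<Longrightarrow> concat (map f xs) \<cong>\<^sub>F concat (map g xs)"
  by (induction xs) (auto intro: weq_append)

lemma commutator_products:
  assumes "reduced U"
  shows "(\<exists>vs. length vs = n \<and> set vs \<subseteq> commutators free_group \<and> list_prod free_group vs = U) \<longleftrightarrow>
    (\<exists>us. length us = n \<and> U \<cong>\<^sub>F prodc us)"
proof
  assume "\<exists>vs. length vs = n \<and> set vs \<subseteq> commutators free_group \<and> list_prod free_group vs = U"
  then obtain vs where vs: "length vs = n" "set vs \<subseteq> commutators free_group" "list_prod free_group vs = U"
    by blast
  have "\<exists>f. \<forall>v\<in>set vs. v = reduce (prodc [f v])"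
  proof (intro bchoice ballI)
    fix v assume "v \<in> set vs"
    then obtain a b where "reduced a" "reduced b" "v = commutator free_group a b"
      using vs(2) by (auto simp: commutators_def)
    then show "\<exists>p. v = reduce (prodc [p])" by (intro exI[of _ "(a, b)"]) (simp add: commutator_free_group)
  qed
  then obtain f where f: "\<And>v. v \<in> set vs \<Longrightarrow> v = reduce (prodc [f v])" by blast
  have "concat (map (\<lambda>v. v) vs) \<cong>\<^sub>F concat (map (\<lambda>v. prodc [f v]) vs)"
    by (rule weq_concat_map) (metis f weq_reduce)
  also have "concat (map (\<lambda>v. prodc [f v]) vs) = prodc (map f vs)"
    by (simp add: prodc_def o_def)
  finally have "reduce (concat vs) \<cong>\<^sub>F prodc (map f vs)"
    using weq_trans[OF weq_reduce] by simp
  then have "U \<cong>\<^sub>F prodc (map f vs)"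
    using vs(3) by (simp add: list_prod_free_group)
  then show "\<exists>us. length us = n \<and> U \<cong>\<^sub>F prodc us"
    using vs(1) by (intro exI[of _ "map f vs"]) simp
next
  assume "\<exists>us. length us = n \<and> U \<cong>\<^sub>F prodc us"
  then obtain us where us: "length us = n" "U \<cong>\<^sub>F prodc us" by blast
  define f where "f = (\<lambda>(a :: 'a letter list, b). commutator free_group (reduce a) (reduce b))"
  have "set (map f us) \<subseteq> commutators free_group"
    by (auto simp: f_def commutators_def intro!: exI)
  moreover have "list_prod free_group (map f us) = U"
  proof -
    have "concat (map f us) \<cong>\<^sub>F concat (map (\<lambda>(a, b). winv a @ winv b @ a @ b) us)"
    proof (rule weq_concat_map)
      fix p :: "'a letter list \<times> 'a letter list"
      obtain a b where p: "p = (a, b)" by force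
      have "reduce (winv (reduce a) @ winv (reduce b) @ reduce a @ reduce b) \<cong>\<^sub>F winv a @ winv b @ a @ b"
        by (intro weq_trans[OF weq_reduce] weq_append weq_winv weq_reduce)
      then show "f p \<cong>\<^sub>F (case p of (a, b) \<Rightarrow> winv a @ winv b @ a @ b)"
        by (simp add: p f_def commutator_free_group)
    qed
    then have "concat (map f us) \<cong>\<^sub>F U"
      by (rule weq_trans) (rule weq_sym[OF us(2)[unfolded prodc_def]])
    then show ?thesis using assms by (simp add: list_prod_free_group weq_def reduce_reduced)
  qed
  ultimately show "\<exists>vs. length vs = n \<and> set vs \<subseteq> commutators free_group \<and> list_prod free_group vs = U"
    using us(1) by (intro exI[of _ "map f us"]) simp
qed

lemma square_products:
  assumes "reduced U"
  shows "(\<exists>vs. length vs = n \<and> set vs \<subseteq> squares free_group \<and> list_prod free_group vs = U) \<longleftrightarrow>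
    (\<exists>us. length us = n \<and> U \<cong>\<^sub>F prods us)"
proof
  assume "\<exists>vs. length vs = n \<and> set vs \<subseteq> squares free_group \<and> list_prod free_group vs = U"
  then obtain vs where vs: "length vs = n" "set vs \<subseteq> squares free_group" "list_prod free_group vs = U"
    by blast
  have "\<exists>f. \<forall>v\<in>set vs. v = reduce (prods [f v])"
    by (rule bchoice) (use vs(2) in \<open>auto simp: squares_def\<close>)
  then obtain f where f: "\<And>v. v \<in> set vs \<Longrightarrow> v = reduce (prods [f v])" by blast
  have "concat (map (\<lambda>v. v) vs) \<cong>\<^sub>F concat (map (\<lambda>v. prods [f v]) vs)"
    by (rule weq_concat_map) (metis f weq_reduce)
  also have "concat (map (\<lambda>v. prods [f v]) vs) = prods (map f vs)"
    by (simp add: prods_def o_def)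
  finally have "reduce (concat vs) \<cong>\<^sub>F prods (map f vs)"
    using weq_trans[OF weq_reduce] by simp
  then have "U \<cong>\<^sub>F prods (map f vs)"
    using vs(3) by (simp add: list_prod_free_group)
  then show "\<exists>us. length us = n \<and> U \<cong>\<^sub>F prods us"
    using vs(1) by (intro exI[of _ "map f vs"]) simp
next
  assume "\<exists>us. length us = n \<and> U \<cong>\<^sub>F prods us"
  then obtain us where us: "length us = n" "U \<cong>\<^sub>F prods us" by blast
  define f where "f = (\<lambda>a :: 'a letter list. reduce (reduce a @ reduce a))"
  have "f a \<in> squares free_group" for a
  proof -
    have "f a = reduce a \<otimes>\<^bsub>free_group\<^esub> reduce a" by (simp add: f_def)
    moreover have "reduce a \<in> carrier free_group" by simp
    ultimately show ?thesis unfolding squares_def by blast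
  qed
  then have "set (map f us) \<subseteq> squares free_group" by auto
  moreover have "list_prod free_group (map f us) = U"
  proof -
    have "concat (map f us) \<cong>\<^sub>F concat (map (\<lambda>a. a @ a) us)"
      unfolding f_def reduce_reduce_append by (rule weq_concat_map) (rule weq_reduce)
    then have "concat (map f us) \<cong>\<^sub>F U"
      by (rule weq_trans) (rule weq_sym[OF us(2)[unfolded prods_def]])
    then show ?thesis using assms by (simp add: list_prod_free_group weq_def reduce_reduced)
  qed
  ultimately show "\<exists>vs. length vs = n \<and> set vs \<subseteq> squares free_group \<and> list_prod free_group vs = U"
    using us(1) by (intro exI[of _ "map f us"]) simp
qed

lemma list_prod_generate:
  "set vs \<subseteq> S \<Longrightarrow> list_prod G vs \<in> generate G S"
  by (induction vs) (auto simp: list_prod_def intro: generate.one generate.eng generate.incl)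

text \<open>The library's commutators have the form x y x^-1 y^-1; the two conventions are exchanged
  by inverting both entries.\<close>

lemma commutators_subset:
  fixes G (structure)
  assumes "group G"
  shows "commutators G \<subseteq> derived_set G (carrier G)"
proof
  interpret group G by fact
  fix c assume "c \<in> commutators G"
  then obtain x y where xy: "x \<in> carrier G" "y \<in> carrier G" "c = commutator G x y"
    by (auto simp: commutators_def)
  then have "c = inv x \<otimes> inv y \<otimes> inv (inv x) \<otimes> inv (inv y)" by (simp add: commutator_def)
  with xy show "c \<in> derived_set G (carrier G)" by blast
qed

text \<open>A factorisation places U in the derived subgroup, so the genus is finite and its minimum
  is attained by some \<open>us'\<close>.\<close>

lemma genus_plus_prodc:
  assumes "reduced U" "U \<cong>\<^sub>F prodc us"
  obtains us' where "U \<cong>\<^sub>F prodc us'" "genus_plus free_group U = enat (length us')" "length us' \<le> length us"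
proof -
  define P where "P n \<longleftrightarrow> (\<exists>vs. length vs = n \<and> set vs \<subseteq> commutators free_group \<and> list_prod free_group vs = U)" for n
  have P: "P n \<longleftrightarrow> (\<exists>us. length us = n \<and> U \<cong>\<^sub>F prodc us)" for n
    unfolding P_def by (rule commutator_products[OF assms(1)])
  have Pn: "P (length us)" using P assms(2) by blast
  then obtain vs where vs: "set vs \<subseteq> commutators free_group" "list_prod free_group vs = U"
    unfolding P_def by blast
  from list_prod_generate[OF subset_trans[OF vs(1) commutators_subset[OF group_free_group]], of free_group]
  have "U \<in> derived free_group (carrier free_group)"
    unfolding derived_def vs(2) .
  then have "genus_plus free_group U = enat (LEAST n. P n)"
    unfolding genus_plus_def min_factors_def P_def by simp
  moreover have "P (LEAST n. P n)" "(LEAST n. P n) \<le> length us"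
    using Pn by (rule LeastI, rule Least_le)
  ultimately show ?thesis using that P by metis
qed

lemma genus_minus_prods:
  assumes "reduced U" "U \<cong>\<^sub>F prods us"
  obtains us' where "U \<cong>\<^sub>F prods us'" "genus_minus free_group U = enat (length us')" "length us' \<le> length us"
proof -
  define P where "P n \<longleftrightarrow> (\<exists>vs. length vs = n \<and> set vs \<subseteq> squares free_group \<and> list_prod free_group vs = U)" for n
  have P: "P n \<longleftrightarrow> (\<exists>us. length us = n \<and> U \<cong>\<^sub>F prods us)" for n
    unfolding P_def by (rule square_products[OF assms(1)])
  have Pn: "P (length us)" using P assms(2) by blast
  then obtain vs where vs: "set vs \<subseteq> squares free_group" "list_prod free_group vs = U"
    unfolding P_def by blast
  from list_prod_generate[OF vs(1), of free_group]
  have "U \<in> generate free_group (squares free_group)"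
    unfolding vs(2) .
  then have "genus_minus free_group U = enat (LEAST n. P n)"
    unfolding genus_minus_def min_factors_def P_def by simp
  moreover have "P (LEAST n. P n)" "(LEAST n. P n) \<le> length us"
    using Pn by (rule LeastI, rule Least_le)
  ultimately show ?thesis using that P by metis
qed

lemma ext_prodc: "ext f (prodc us) = prodc (map (\<lambda>(a, b). (ext f a, ext f b)) us)"
  by (induction us) (auto split: prod.splits)

lemma ext_prods: "ext f (prods us) = prods (map (ext f) us)"
  by (induction us) auto

subsection \<open>Exponent sums\<close>

fun es :: "'a \<Rightarrow> 'a letter list \<Rightarrow> int" where
  "es x [] = 0"
| "es x (p # u) = (if fst p = x then if snd p then 1 else - 1 else 0) + es x u"

lemma es_append [simp]: "es x (u @ v) = es x u + es x v"
  by (induction u) auto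

lemma es_winv [simp]: "es x (winv u) = - es x u"
  by (induction u) auto

lemma es_cons_cancel: "es x (cons_cancel p u) = es x (p # u)"
  by (cases u) auto

lemma es_reduce: "es x (reduce u) = es x u"
  by (induction u) (auto simp: reduce_def es_cons_cancel)

lemma es_weq: "u \<cong>\<^sub>F v \<Longrightarrow> es x u = es x v"
  by (metis es_reduce weq_def)

lemma es_ext_reduce: "es x (ext f (reduce u)) = es x (ext f u)"
  by (rule es_weq[OF ext_reduce])

lemma es_notin: "x \<notin> vars u \<Longrightarrow> es x u = 0"
  by (induction u) auto

text \<open>The substitution f is kept general so that the exponent sums can be taken in W itself or
  after carrying W back to the standard word.\<close>

lemma es_derived:
  assumes "w \<in> derived free_group (carrier free_group)"
  shows "es x (ext f w) = 0"
proof -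
  have base: "reduced h \<and> es x (ext f h) = 0"
    if h: "h \<in> derived_set free_group (carrier free_group)" for h
  proof -
    from h obtain a b where ab: "a \<in> carrier free_group" "b \<in> carrier free_group"
      and eq: "h = a \<otimes>\<^bsub>free_group\<^esub> b \<otimes>\<^bsub>free_group\<^esub> inv\<^bsub>free_group\<^esub> a \<otimes>\<^bsub>free_group\<^esub> inv\<^bsub>free_group\<^esub> b"
      by blast
    have "h = reduce (reduce (reduce (a @ b) @ winv a) @ winv b)" using ab unfolding eq by simp
    then show ?thesis by (simp add: es_ext_reduce)
  qed
  have "reduced w \<and> es x (ext f w) = 0"
    using assms unfolding derived_def
  proof (induction rule: generate.induct)
    case one
    show ?case by simp
  next
    case (incl h)
    then show ?case by (rule base)
  next
    case (inv h)
    show ?case using base[OF inv] by (simp add: reduced_winv)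
  next
    case (eng u v)
    then show ?case by (simp add: es_ext_reduce)
  qed
  then show ?thesis by blast
qed

text \<open>A letter occurring twice with the same sign would give exponent sum 2 or -2.\<close>

lemma qlist_balanced_distinct:
  assumes "qlist w" "\<And>x. es x w = 0"
  shows "distinct w"
proof (rule ccontr)
  assume "\<not> distinct w"
  then obtain a p b c where w: "w = a @ p # b @ p # c" using not_distinct_decomp by fastforce
  note fresh = qlist_fresh[OF assms(1)[unfolded w] refl]
  have "es (fst p) w \<noteq> 0" using fresh by (simp add: w es_notin)
  with assms(2) show False by blast
qed

subsection \<open>Automorphisms\<close>

lemma hom_free_group_ext:
  assumes "h \<in> hom free_group free_group" "reduced w"
  shows "h w = reduce (ext (\<lambda>x. h (gen x)) w)"
  using assms(2)
proof (induction w)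
  case Nil
  have "h \<one>\<^bsub>free_group\<^esub> = \<one>\<^bsub>free_group\<^esub>"
    by (rule hom_one[OF assms(1) group_free_group group_free_group])
  then show ?case by (simp add: reduce_def)
next
  case (Cons p w)
  have w: "reduced w" using Cons.prems reduced_Cons by blast
  have red: "reduced (h u)" if "reduced u" for u
    using hom_in_carrier[OF assms(1), of u] that by simp
  have g: "reduced (gen x)" "reduced [p]" for x :: 'a and p :: "'a letter"
    by (simp_all add: gen_def reduced_def)
  have "h [p] = ext (\<lambda>x. h (gen x)) [p]"
  proof (cases "snd p")
    case True
    then have "[p] = gen (fst p)" by (auto simp: gen_def prod_eq_iff)
    moreover have "ext (\<lambda>x. h (gen x)) [p] = h (gen (fst p))" using True by simp
    ultimately show ?thesis by metis
  next
    case False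
    then have "[p] = inv\<^bsub>free_group\<^esub> (gen (fst p))"
      using g(1)[of "fst p"] by (auto simp: gen_def prod_eq_iff inv_letter_def)
    moreover have "h (inv\<^bsub>free_group\<^esub> (gen (fst p))) = inv\<^bsub>free_group\<^esub> (h (gen (fst p)))"
      using g(1)[of "fst p"] by (intro group_hom.hom_inv)
        (simp_all add: group_hom_def group_hom_axioms_def group_free_group assms(1))
    moreover have "ext (\<lambda>x. h (gen x)) [p] = winv (h (gen (fst p)))" using False by simp
    ultimately show ?thesis using red[OF g(1)] inv_free_group by metis
  qed
  moreover have "h (p # w) = reduce (h [p] @ h w)"
    using hom_mult[OF assms(1), of "[p]" w] w g(2)[of p] reduce_reduced[OF Cons.prems] by simp
  ultimately have "h (p # w) = reduce (ext (\<lambda>x. h (gen x)) [p] @ reduce (ext (\<lambda>x. h (gen x)) w))"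
    using Cons.IH[OF w] by simp
  also have "\<dots> = reduce (ext (\<lambda>x. h (gen x)) [p] @ ext (\<lambda>x. h (gen x)) w)"
    using weq_append[OF weq_refl weq_reduce] weq_def by blast
  finally show ?case by simp
qed

lemma ext_hom: "(\<lambda>w. reduce (ext f w)) \<in> hom free_group free_group"
proof (rule homI)
  fix u v :: "'a letter list"
  have "ext f (reduce (u @ v)) \<cong>\<^sub>F ext f u @ ext f v" using ext_reduce[of f "u @ v"] by simp
  then show "reduce (ext f (u \<otimes>\<^bsub>free_group\<^esub> v)) =
      reduce (ext f u) \<otimes>\<^bsub>free_group\<^esub> reduce (ext f v)"
    by (simp add: weq_def reduce_reduce_append)
qed simp

text \<open>The restriction to the carrier is there because the elements of \<open>auto\<close> are
  extensional maps.\<close>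

lemma inv_subst_auto:
  assumes "inv_subst s t"
  shows "restrict (\<lambda>w. reduce (ext s w)) (carrier free_group) \<in> auto free_group"
proof -
  have *: "reduce (ext t (reduce (ext s w))) = w" if "inv_subst s t" "reduced w" for s t :: "'a \<Rightarrow> 'a letter list" and w
    using weq_trans[OF ext_reduce inv_subst_ext[OF that(1), of w]] that(2) by (simp add: weq_def reduce_reduced)
  have "bij_betw (restrict (\<lambda>w. reduce (ext s w)) (carrier free_group)) (carrier free_group) (carrier free_group)"
    by (rule bij_betwI[where g = "\<lambda>w. reduce (ext t w)"])
      (simp_all add: *[OF assms] *[OF inv_subst_sym[OF assms]])
  moreover have "restrict (\<lambda>w. reduce (ext s w)) (carrier free_group) \<in> hom free_group free_group"
    using ext_hom[of s] by (simp add: hom_def Pi_def)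
  ultimately show ?thesis by (simp add: auto_def Bij_def)
qed

lemma auto_compose:
  assumes "group G" "f \<in> auto G" "g \<in> auto G"
  shows "compose (carrier G) f g \<in> auto G"
proof -
  have "compose (carrier G) f g \<in> hom G G"
    using assms(2,3) by (intro group.hom_compose[OF assms(1), where H = G]) (simp_all add: auto_def)
  moreover have "compose (carrier G) f g \<in> Bij (carrier G)"
    using assms(2,3) by (intro compose_Bij) (simp_all add: auto_def)
  ultimately show ?thesis by (simp add: auto_def)
qed

subsection \<open>Irredundance and cancellation-free solutions\<close>

text \<open>The letters p and q^-1 open a pair, q and p^-1 close it. A prefix therefore has odd
  parity over the two variables exactly when it stops inside a pair, which is the vertex function
  cut off by the pair.\<close>

lemma only_in_pair_potential:
  assumes only: "only_in_pair w p q" and pq: "fst p \<noteq> fst q"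
  shows "potential w {fst p, fst q} (\<lambda>y. if y = fst p then \<not> snd p else y = fst q \<and> snd q)"
proof -
  let ?v = "{fst p, fst q}"
  have ne: "p \<noteq> q" "p \<noteq> inv_letter q" "inv_letter p \<noteq> q" "q \<noteq> p" "inv_letter q \<noteq> p"
    "q \<noteq> inv_letter p" "inv_letter p \<noteq> inv_letter q" "inv_letter q \<noteq> inv_letter p"
    using pq by auto
  have pair: "\<exists>j. j \<le> i \<and> i \<le> Suc j \<and> Suc j < length w \<and>
      ((w ! j = p \<and> w ! Suc j = q) \<or> (w ! j = inv_letter q \<and> w ! Suc j = inv_letter p))"
    if "i < length w" "w ! i \<in> {p, q, inv_letter p, inv_letter q}" for i
    using only that unfolding only_in_pair_def by blast
  have open_step: "Suc i < length w \<and> w ! Suc i = (if w ! i = p then q else inv_letter p)"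
    if i: "i < length w" "w ! i \<in> {p, inv_letter q}" for i
  proof -
    obtain j where j: "j \<le> i" "i \<le> Suc j" "Suc j < length w"
      "(w ! j = p \<and> w ! Suc j = q) \<or> (w ! j = inv_letter q \<and> w ! Suc j = inv_letter p)"
      using pair[OF i(1)] i(2) by blast
    have "i = j \<or> i = Suc j" using j by linarith
    then show ?thesis using i j ne by auto
  qed
  have close_step: "i > 0 \<and> w ! (i - 1) = (if w ! i = q then p else inv_letter q)"
    if i: "i < length w" "w ! i \<in> {q, inv_letter p}" for i
  proof -
    obtain j where j: "j \<le> i" "i \<le> Suc j" "Suc j < length w"
      "(w ! j = p \<and> w ! Suc j = q) \<or> (w ! j = inv_letter q \<and> w ! Suc j = inv_letter p)"
      using pair[OF i(1)] i(2) by blast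
    have "i = j \<or> i = Suc j" using j by linarith
    then show ?thesis using i j ne by auto
  qed
  have mem: "fst m \<in> ?v \<longleftrightarrow> m \<in> {p, inv_letter q} \<or> m \<in> {q, inv_letter p}" for m
    using pq by (cases m; cases p; cases q) (auto simp: inv_letter_def)
  have parity: "i \<le> length w \<Longrightarrow> par ?v (take i w) = (i > 0 \<and> w ! (i - 1) \<in> {p, inv_letter q})" for i
  proof (induction i)
    case (Suc i)
    then have i: "i < length w" by simp
    have IH: "par ?v (take i w) = (i > 0 \<and> w ! (i - 1) \<in> {p, inv_letter q})" using Suc by simp
    have step: "par ?v (take (Suc i) w) = (par ?v (take i w) \<noteq> (fst (w ! i) \<in> ?v))"
      using i by (simp add: take_Suc_conv_app_nth)
    have prev: "w ! i \<in> {q, inv_letter p}" if "par ?v (take i w)"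
    proof -
      have "i > 0" "w ! (i - 1) \<in> {p, inv_letter q}" using that IH by auto
      then show ?thesis using open_step[of "i - 1"] i by (auto split: if_splits)
    qed
    have prev_conv: "par ?v (take i w)" if "w ! i \<in> {q, inv_letter p}"
      using close_step[OF i that] IH by (auto split: if_splits)
    have "w ! i \<in> {p, inv_letter q} \<Longrightarrow> w ! i \<notin> {q, inv_letter p}" using ne by auto
    then show ?case using step prev prev_conv mem[of "w ! i"] by auto
  qed simp
  have "tail ?v a m = (if fst m = fst p then \<not> snd p else fst m = fst q \<and> snd q)" if w: "w = a @ m # b" for a m b
  proof -
    have i: "length a < length w" "w ! length a = m" "take (length a) w = a" using w by auto
    have par: "par ?v a = (length a > 0 \<and> w ! (length a - 1) \<in> {p, inv_letter q})"
      using parity[of "length a"] i by simp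
    have 1: "par ?v a" if "m \<in> {q, inv_letter p}"
      using close_step[OF i(1)] that i(2) par by (auto split: if_splits)
    have 2: "m \<in> {q, inv_letter p}" if "par ?v a"
    proof -
      have "length a > 0" "w ! (length a - 1) \<in> {p, inv_letter q}" using that par by auto
      then show ?thesis using open_step[of "length a - 1"] i by (auto split: if_splits)
    qed
    have "par ?v a \<longleftrightarrow> m \<in> {q, inv_letter p}" using 1 2 by blast
    then show ?thesis
      using pq by (cases m; cases p; cases q) (auto simp: tail_def inv_letter_def)
  qed
  then show ?thesis unfolding potential_def by blast
qed

lemma infinite_variable: "infinite (UNIV :: variable set)"
proof
  assume "finite (UNIV :: variable set)"
  then have "finite (range X)" by (rule finite_subset[rotated]) simp
  then show False using finite_imageD[of X UNIV] by (simp add: inj_def)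
qed

lemma ext_filter: "\<psi> x = [] \<Longrightarrow> ext \<psi> (filter (\<lambda>p. fst p \<noteq> x) w) = ext \<psi> w"
  by (induction w) auto

lemma hom_weq_ext:
  assumes "h \<in> hom free_group free_group"
  shows "h (reduce u) \<cong>\<^sub>F ext (\<lambda>x. h (gen x)) u"
proof -
  have "h (reduce u) = reduce (ext (\<lambda>x. h (gen x)) (reduce u))"
    by (rule hom_free_group_ext[OF assms reduced_reduce])
  then show ?thesis by (simp only: weq_trans[OF weq_reduce ext_reduce])
qed

text \<open>The pair s, t is returned along with W: s presents W as an image of the standard word
  for the genus bound, and t carries W back to that word.\<close>

lemma cancellation_free_solution:
  assumes U: "reduced U" and \<phi>: "\<phi> \<in> hom FreeX FreeA" "\<phi> (reduce Q) = U" and Q: "qlist Q"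
    and triv: "\<And>W \<psi> x. reach Q (\<lambda>x. \<phi> (gen x)) W \<psi> \<Longrightarrow> x \<in> vars W \<Longrightarrow> \<psi> x = [] \<Longrightarrow>
      \<exists>v. radical W v \<and> x \<in> v"
  obtains W \<psi> s t where "inv_subst s t" "ext s Q \<cong>\<^sub>F W" "quadratic W" "irredundant W"
    "solution \<psi> W U" "cancellation_free \<psi> W U"
    "\<forall>\<gamma>\<in>auto FreeX. \<gamma> W = reduce Q \<longrightarrow> (\<exists>\<alpha>\<in>Stab (reduce Q). \<forall>x\<in>vars (reduce Q).
       \<phi> (gen x) = \<psi> (inv_into (carrier FreeX) \<gamma> (\<alpha> (gen x))))"
proof -
  let ?\<phi> = "\<lambda>x. \<phi> (gen x)"
  have gen: "gen x \<in> carrier free_group" for x :: variable by (simp add: gen_def reduced_def)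
  have red\<phi>: "reduced (?\<phi> x)" for x
    using hom_in_carrier[OF \<phi>(1) gen] by simp
  obtain W \<psi> where W: "reach Q ?\<phi> W \<psi>" "\<And>x. x \<in> vars W \<Longrightarrow> \<psi> x \<noteq> []" "reduced W" "reduced (ext \<psi> W)"
    and irr: "\<And>p q. fst p \<in> vars W \<Longrightarrow> fst q \<in> vars W \<Longrightarrow> fst p \<noteq> fst q \<Longrightarrow>
      \<not> potential W {fst p, fst q} (\<lambda>y. if y = fst p then \<not> snd p else y = fst q \<and> snd q)"
    by (rule descent[OF infinite_variable Q red\<phi> triv]) (assumption | blast)+
  obtain s t where st: "inv_subst s t" "ext s Q \<cong>\<^sub>F W" "\<And>x. x \<in> vars Q \<Longrightarrow> ext \<psi> (s x) \<cong>\<^sub>F ?\<phi> x"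
    using W(1) unfolding reach_def by blast
  have red\<psi>: "reduced (\<psi> x)" for x by (rule reach_reduced[OF W(1)])
  define \<Psi> where "\<Psi> = (\<lambda>w. reduce (ext \<psi> w))"
  have "ext \<psi> W \<cong>\<^sub>F ext ?\<phi> Q" by (rule reach_weq[OF W(1)])
  moreover have "U \<cong>\<^sub>F ext ?\<phi> Q" using hom_weq_ext[OF \<phi>(1), of Q] unfolding \<phi>(2) .
  ultimately have \<psi>U: "ext \<psi> W = U"
    by (intro weq_reduced[OF _ W(4) U]) (rule weq_trans[OF _ weq_sym])
  have letter: "\<Psi> [l] = ext \<psi> [l]" for l
  proof -
    have "reduced (ext \<psi> [l])" using red\<psi> reduced_winv by auto
    then show ?thesis unfolding \<Psi>_def by (rule reduce_reduced)
  qed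
  have "solution \<Psi> W U"
    unfolding solution_def using ext_hom[of \<psi>] \<psi>U reduce_reduced[OF U] by (simp add: \<Psi>_def)
  moreover have "cancellation_free \<Psi> W U"
  proof -
    have "\<Psi> (gen x) = \<psi> x" for x using letter[of "(x, True)"] by (simp add: gen_def)
    moreover have "concat (map (\<lambda>l. \<Psi> [l]) w) = ext \<psi> w" for w
      unfolding letter by (induction w) auto
    ultimately show ?thesis unfolding cancellation_free_def using W(2) \<psi>U by simp
  qed
  moreover have "quadratic W"
    using W(3) reach_qlist[OF W(1)] by (auto simp: quadratic_def qlist_altdef)
  moreover have "irredundant W"
    unfolding irredundant_def
  proof
    assume "\<exists>p q. fst p \<in> vars W \<and> fst q \<in> vars W \<and> p \<noteq> q \<and> p \<noteq> inv_letter q \<and> only_in_pair W p q"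
    then obtain p q where pq: "fst p \<in> vars W" "fst q \<in> vars W" "p \<noteq> q" "p \<noteq> inv_letter q" "only_in_pair W p q"
      by blast
    then have "fst p \<noteq> fst q" by (cases p; cases q) (auto simp: inv_letter_def)
    then show False using irr[OF pq(1,2)] only_in_pair_potential[OF pq(5)] by blast
  qed
  moreover have "\<exists>\<alpha>\<in>Stab (reduce Q). \<forall>x\<in>vars (reduce Q).
       \<phi> (gen x) = \<Psi> (inv_into (carrier FreeX) \<gamma> (\<alpha> (gen x)))"
    if \<gamma>: "\<gamma> \<in> auto FreeX" "\<gamma> W = reduce Q" for \<gamma>
  proof -
    \<comment> \<open>With maps on the left, \<open>?\<alpha>\<close> applies \<delta> first.
      Undoing \<gamma> leaves the reduced image under s, where \<psi> agrees with \<phi>; hence any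
      \<gamma> works.\<close>
    define \<delta> where "\<delta> = restrict (\<lambda>w. reduce (ext s w)) (carrier FreeX)"
    let ?\<alpha> = "compose (carrier FreeX) \<gamma> \<delta>"
    have "?\<alpha> \<in> auto FreeX"
      unfolding \<delta>_def by (rule auto_compose[OF group_free_group \<gamma>(1) inv_subst_auto[OF st(1)]])
    moreover have "?\<alpha> (reduce Q) = reduce Q"
    proof -
      have "ext s (reduce Q) \<cong>\<^sub>F W" by (rule weq_trans[OF ext_reduce st(2)])
      then have "reduce (ext s (reduce Q)) = W" using reduce_reduced[OF W(3)] by (simp add: weq_def)
      then show ?thesis using \<gamma>(2) by (simp add: compose_def \<delta>_def)
    qed
    moreover have "\<phi> (gen x) = \<Psi> (inv_into (carrier FreeX) \<gamma> (?\<alpha> (gen x)))" if "x \<in> vars (reduce Q)" for x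
    proof -
      have inj: "inj_on \<gamma> (carrier FreeX)" using \<gamma>(1) by (auto simp: auto_def Bij_def bij_betw_def)
      have "?\<alpha> (gen x) = \<gamma> (reduce (s x))" using gen[of x] by (simp add: compose_def \<delta>_def gen_def)
      then have "inv_into (carrier FreeX) \<gamma> (?\<alpha> (gen x)) = reduce (s x)"
        using inv_into_f_f[OF inj, of "reduce (s x)"] by simp
      then have "\<Psi> (inv_into (carrier FreeX) \<gamma> (?\<alpha> (gen x))) = reduce (ext \<psi> (reduce (s x)))"
        by (simp add: \<Psi>_def)
      also have "\<dots> = reduce (?\<phi> x)"
        using weq_trans[OF ext_reduce st(3)[OF subsetD[OF vars_reduce that]]] unfolding weq_def .
      finally show ?thesis using reduce_reduced[OF red\<phi>] by simp
    qed
    ultimately show ?thesis unfolding Stab_def by blast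
  qed
  ultimately show ?thesis by (intro that[OF st(1,2)] ballI impI)
qed

subsection \<open>The standard words\<close>

definition comm_list :: "nat \<Rightarrow> variable letter list" where
  "comm_list g = prodc (map (\<lambda>i. ([(X i, True)], [(Y i, True)])) [0..<g])"

definition square_list :: "nat \<Rightarrow> variable letter list" where
  "square_list g = prods (map (\<lambda>i. [(X i, True)]) [0..<g])"

lemma commutator_word_eq: "commutator_word g = reduce (comm_list g)"
proof -
  let ?f = "\<lambda>i. commutator FreeX (gen (X i)) (gen (Y i))"
  let ?h = "\<lambda>i. winv [(X i, True)] @ winv [(Y i, True)] @ [(X i, True)] @ [(Y i, True)]"
  have "?f i \<cong>\<^sub>F ?h i" for i
    by (subst commutator_free_group) (auto simp: gen_def reduced_def)
  then have "concat (map ?f [0..<g]) \<cong>\<^sub>F concat (map ?h [0..<g])" by (rule weq_concat_map)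
  then show ?thesis
    by (simp add: commutator_word_def list_prod_free_group comm_list_def prodc_def o_def weq_def)
qed

lemma square_word_eq: "square_word g = reduce (square_list g)"
proof -
  let ?f = "\<lambda>i. gen (X i) \<otimes>\<^bsub>FreeX\<^esub> gen (X i)"
  let ?h = "\<lambda>i. [(X i, True)] @ [(X i, True)]"
  have "?f i \<cong>\<^sub>F ?h i" for i
    by (simp add: gen_def)
  then have "concat (map ?f [0..<g]) \<cong>\<^sub>F concat (map ?h [0..<g])" by (rule weq_concat_map)
  then show ?thesis
    by (simp add: square_word_def list_prod_free_group square_list_def prods_def o_def weq_def)
qed

lemma prodc_append: "prodc (us @ vs) = prodc us @ prodc vs"
  by (simp add: prodc_def)

lemma prods_append: "prods (us @ vs) = prods us @ prods vs"
  by (simp add: prods_def)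

lemma cnt_comm_list: "cnt (comm_list g) (X i) = (if i < g then 2 else 0)"
  "cnt (comm_list g) (Y i) = (if i < g then 2 else 0)"
  by (induction g) (auto simp: comm_list_def prodc_append)

lemma cnt_square_list: "cnt (square_list g) (X i) = (if i < g then 2 else 0)"
  "cnt (square_list g) (Y i) = 0"
  by (induction g) (auto simp: square_list_def prods_append)

lemma qlist_comm_list: "qlist (comm_list g)"
  unfolding qlist_def
proof
  fix x show "cnt (comm_list g) x = 0 \<or> cnt (comm_list g) x = 2"
    by (cases x) (simp_all add: cnt_comm_list)
qed

lemma qlist_square_list: "qlist (square_list g)"
  unfolding qlist_def
proof
  fix x show "cnt (square_list g) x = 0 \<or> cnt (square_list g) x = 2"
    by (cases x) (simp_all add: cnt_square_list)
qed

lemma es_square_list: "es (X i) (square_list g) = (if i < g then 2 else 0)"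
  by (induction g) (auto simp: square_list_def prods_append)

section \<open>The orientable and the nonorientable case\<close>

lemma orientable_prodc:
  assumes "reduced w" "w \<cong>\<^sub>F prodc us"
  shows "w \<in> derived free_group (carrier free_group)"
proof -
  obtain us' where "w \<cong>\<^sub>F prodc us'" "genus_plus free_group w = enat (length us')" "length us' \<le> length us"
    using genus_plus_prodc[OF assms] .
  then show ?thesis by (auto simp: genus_plus_def split: if_splits)
qed

lemma orientable_case:
  assumes U: "reduced U" and g: "genus_plus FreeA U = enat g" and \<phi>: "solution \<phi> (commutator_word g) U"
  shows "\<exists>W \<psi>. quadratic W \<and> orientable W \<and> irredundant W \<and> genus_plus FreeX W = enat g \<and>
    solution \<psi> W U \<and> cancellation_free \<psi> W U \<and>
    (\<forall>\<gamma>\<in>auto FreeX. \<gamma> W = commutator_word g \<longrightarrow>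
       (\<exists>\<alpha>\<in>Stab (commutator_word g). \<forall>x\<in>vars (commutator_word g).
          \<phi> (gen x) = \<psi> (inv_into (carrier FreeX) \<gamma> (\<alpha> (gen x)))))"
proof -
  let ?Q = "comm_list g"
  have hom: "\<phi> \<in> hom FreeX FreeA" "\<phi> (reduce ?Q) = U"
    using \<phi> by (auto simp: solution_def commutator_word_eq)
  have lower: "g \<le> length us" if "U \<cong>\<^sub>F prodc us" for us
    by (rule genus_plus_prodc[OF U that]) (use g in simp)
  have extQ: "\<exists>us. length us = g \<and> ext s ?Q = prodc us" for s :: "variable \<Rightarrow> variable letter list"
    unfolding comm_list_def ext_prodc by (rule exI[of _ "map _ (map _ [0..<g])"]) simp
  have "\<exists>v. radical W v \<and> x \<in> v"
    if W: "reach ?Q (\<lambda>x. \<phi> (gen x)) W \<psi>" and x: "x \<in> vars W" "\<psi> x = []" for W \<psi> x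
  proof (rule ccontr)
    assume "\<not> (\<exists>v. radical W v \<and> x \<in> v)"
    then have norad: "\<And>v. radical W v \<Longrightarrow> x \<notin> v" by blast
    let ?W = "filter (\<lambda>p. fst p \<noteq> x) W"
    obtain s where s: "ext s ?Q \<cong>\<^sub>F W" using W unfolding reach_def by blast
    then obtain us where us: "length us = g" "W \<cong>\<^sub>F prodc us" using extQ[of s] weq_sym[OF s] by auto
    \<comment> \<open>Exponent sums vanish, so no letter of W repeats. This persists when x is
      erased, and the commutator branch of \<open>rank_drop\<close> applies.\<close>
    have "reduce W \<in> derived free_group (carrier free_group)"
      by (rule orientable_prodc[of _ us]) (use us(2) in \<open>simp_all add: weq_def reduce_reduced\<close>)
    from es_derived[OF this, of _ idf] have "es y W = 0" for y
      by (simp add: ext_id es_reduce)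
    then have "distinct W" by (rule qlist_balanced_distinct[OF reach_qlist[OF W]])
    then have "distinct ?W" by simp
    then obtain vs where vs: "?W \<cong>\<^sub>F prodc vs" "2 * length vs < 2 * g"
      using rank_drop[OF reach_qlist[OF W] x(1) norad rank_prodc[OF us(2) vars_simps(5)]] us(1) by auto
    have "U \<cong>\<^sub>F ext \<psi> W"
      using weq_trans[OF hom_weq_ext[OF hom(1)] weq_sym[OF reach_weq[OF W]]] unfolding hom(2) .
    also have "ext \<psi> W = ext \<psi> ?W" by (rule ext_filter[of \<psi>, symmetric]) (rule x(2))
    also have "\<dots> \<cong>\<^sub>F ext \<psi> (prodc vs)" by (rule ext_weq[OF vs(1)])
    finally have "g \<le> length (map (\<lambda>(a, b). (ext \<psi> a, ext \<psi> b)) vs)"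
      unfolding ext_prodc by (rule lower)
    with vs(2) show False by simp
  qed
  note triv = this
  obtain W \<psi> s t where st: "inv_subst s t" "ext s ?Q \<cong>\<^sub>F W"
    and W: "quadratic W" "irredundant W" "solution \<psi> W U" "cancellation_free \<psi> W U"
    "\<forall>\<gamma>\<in>auto FreeX. \<gamma> W = reduce ?Q \<longrightarrow> (\<exists>\<alpha>\<in>Stab (reduce ?Q). \<forall>x\<in>vars (reduce ?Q).
       \<phi> (gen x) = \<psi> (inv_into (carrier FreeX) \<gamma> (\<alpha> (gen x))))"
    by (rule cancellation_free_solution[OF U hom qlist_comm_list triv])
  have red: "reduced W" using W(1) by (simp add: quadratic_def)
  obtain us where us: "length us = g" "W \<cong>\<^sub>F prodc us" using extQ[of s] weq_sym[OF st(2)] by auto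
  obtain us' where us': "W \<cong>\<^sub>F prodc us'" "genus_plus FreeX W = enat (length us')" "length us' \<le> length us"
    using genus_plus_prodc[OF red us(2)] .
  have \<psi>: "\<psi> \<in> hom FreeX FreeA" "\<psi> W = U" using W(3) by (auto simp: solution_def)
  \<comment> \<open>A shortest factorisation of W maps to one of U, so the genus of W is at least g;
    the image of the standard word under s gives the other bound.\<close>
  have "U \<cong>\<^sub>F ext (\<lambda>x. \<psi> (gen x)) (prodc us')"
    using weq_trans[OF hom_weq_ext[OF \<psi>(1)] ext_weq[OF us'(1)]] unfolding reduce_reduced[OF red] \<psi>(2) .
  from lower[OF this[unfolded ext_prodc]] have "g \<le> length us'" by simp
  then have "genus_plus FreeX W = enat g" using us' us(1) by simp
  moreover have "orientable W" unfolding orientable_def by (rule orientable_prodc[OF red us(2)])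
  ultimately show ?thesis using W unfolding commutator_word_eq by blast
qed

lemma nonorientable_case:
  assumes U: "reduced U" "U \<noteq> []" and g: "genus_minus FreeA U = enat g"
    and g2: "enat g \<le> 2 * genus_plus FreeA U" and \<phi>: "solution \<phi> (square_word g) U"
  shows "\<exists>W \<psi>. quadratic W \<and> \<not> orientable W \<and> irredundant W \<and> genus_minus FreeX W = enat g \<and>
    solution \<psi> W U \<and> cancellation_free \<psi> W U \<and>
    (\<forall>\<gamma>\<in>auto FreeX. \<gamma> W = square_word g \<longrightarrow>
       (\<exists>\<alpha>\<in>Stab (square_word g). \<forall>x\<in>vars (square_word g).
          \<phi> (gen x) = \<psi> (inv_into (carrier FreeX) \<gamma> (\<alpha> (gen x)))))"
proof -
  let ?Q = "square_list g"
  have hom: "\<phi> \<in> hom FreeX FreeA" "\<phi> (reduce ?Q) = U"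
    using \<phi> by (auto simp: solution_def square_word_eq)
  have lower: "g \<le> length us" if "U \<cong>\<^sub>F prods us" for us
    by (rule genus_minus_prods[OF U(1) that]) (use g in simp)
  have lower2: "g \<le> 2 * length us" if comm: "U \<cong>\<^sub>F prodc us" for us
  proof -
    obtain us' where us': "genus_plus FreeA U = enat (length us')" "length us' \<le> length us"
      and "U \<cong>\<^sub>F prodc us'"
      by (rule genus_plus_prodc[OF U(1) comm])
    have "enat g \<le> enat (2 * length us')" using g2 us'(1) by (simp add: numeral_eq_enat)
    with us'(2) show ?thesis by simp
  qed
  \<comment> \<open>An empty left-hand side would make U trivial. Positivity makes the first
    variable occur in the square word, whose exponent sum then detects nonorientability.\<close>
  have gpos: "0 < g"
    using hom(2) U hom_one[OF hom(1) group_free_group group_free_group]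
    by (cases g) (auto simp: square_list_def reduce_def)
  have extQ: "\<exists>us. length us = g \<and> ext s ?Q = prods us" for s :: "variable \<Rightarrow> variable letter list"
    unfolding square_list_def ext_prods by (rule exI[of _ "map _ (map _ [0..<g])"]) simp
  have "\<exists>v. radical W v \<and> x \<in> v"
    if W: "reach ?Q (\<lambda>x. \<phi> (gen x)) W \<psi>" and x: "x \<in> vars W" "\<psi> x = []" for W \<psi> x
  proof (rule ccontr)
    assume "\<not> (\<exists>v. radical W v \<and> x \<in> v)"
    then have norad: "\<And>v. radical W v \<Longrightarrow> x \<notin> v" by blast
    let ?W = "filter (\<lambda>p. fst p \<noteq> x) W"
    obtain s where s: "ext s ?Q \<cong>\<^sub>F W" using W unfolding reach_def by blast
    then obtain us where us: "length us = g" "W \<cong>\<^sub>F prods us" using extQ[of s] weq_sym[OF s] by auto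
    note drop = rank_drop[OF reach_qlist[OF W] x(1) norad rank_prods[OF us(2) vars_simps(5)]]
    have "U \<cong>\<^sub>F ext \<psi> W"
      using weq_trans[OF hom_weq_ext[OF hom(1)] weq_sym[OF reach_weq[OF W]]] unfolding hom(2) .
    also have "ext \<psi> W = ext \<psi> ?W" by (rule ext_filter[of \<psi>, symmetric]) (rule x(2))
    finally have UW: "U \<cong>\<^sub>F ext \<psi> ?W" .
    show False
    \<comment> \<open>Erasing x may leave an orientable word. Then U is a product of fewer than g/2
      commutators, contradicting \<open>lower2\<close>; otherwise it is a product of fewer than g
      squares.\<close>
    proof (cases "distinct ?W")
      case True
      then obtain vs where vs: "?W \<cong>\<^sub>F prodc vs" "2 * length vs < g" using drop us(1) by auto
      have "g \<le> 2 * length (map (\<lambda>(a, b). (ext \<psi> a, ext \<psi> b)) vs)"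
        using weq_trans[OF UW ext_weq[OF vs(1)]] unfolding ext_prodc by (rule lower2)
      with vs(2) show False by simp
    next
      case False
      then obtain vs where vs: "?W \<cong>\<^sub>F prods vs" "length vs < g" using drop us(1) by auto
      have "g \<le> length (map (ext \<psi>) vs)"
        using weq_trans[OF UW ext_weq[OF vs(1)]] unfolding ext_prods by (rule lower)
      with vs(2) show False by simp
    qed
  qed
  note triv = this
  obtain W \<psi> s t where st: "inv_subst s t" "ext s ?Q \<cong>\<^sub>F W"
    and W: "quadratic W" "irredundant W" "solution \<psi> W U" "cancellation_free \<psi> W U"
    "\<forall>\<gamma>\<in>auto FreeX. \<gamma> W = reduce ?Q \<longrightarrow> (\<exists>\<alpha>\<in>Stab (reduce ?Q). \<forall>x\<in>vars (reduce ?Q).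
       \<phi> (gen x) = \<psi> (inv_into (carrier FreeX) \<gamma> (\<alpha> (gen x))))"
    by (rule cancellation_free_solution[OF U(1) hom qlist_square_list triv])
  have red: "reduced W" using W(1) by (simp add: quadratic_def)
  obtain us where us: "length us = g" "W \<cong>\<^sub>F prods us" using extQ[of s] weq_sym[OF st(2)] by auto
  obtain us' where us': "W \<cong>\<^sub>F prods us'" "genus_minus FreeX W = enat (length us')" "length us' \<le> length us"
    using genus_minus_prods[OF red us(2)] .
  have \<psi>: "\<psi> \<in> hom FreeX FreeA" "\<psi> W = U" using W(3) by (auto simp: solution_def)
  have "U \<cong>\<^sub>F ext (\<lambda>x. \<psi> (gen x)) (prods us')"
    using weq_trans[OF hom_weq_ext[OF \<psi>(1)] ext_weq[OF us'(1)]] unfolding reduce_reduced[OF red] \<psi>(2) .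
  from lower[OF this[unfolded ext_prods]] have "g \<le> length us'" by simp
  then have "genus_minus FreeX W = enat g" using us' us(1) by simp
  moreover have "\<not> orientable W"
  proof
    assume "orientable W"
    \<comment> \<open>Membership in the derived subgroup would survive the passage back along t, but
      in the square word the first variable has exponent sum 2.\<close>
    then have "es (X 0) (ext t W) = 0" unfolding orientable_def by (rule es_derived)
    moreover have "ext t W \<cong>\<^sub>F ?Q"
      using weq_trans[OF weq_sym[OF ext_weq[OF st(2)]] inv_subst_ext[OF st(1)]] .
    ultimately show False using gpos es_weq[of "ext t W" ?Q "X 0"] by (simp add: es_square_list)
  qed
  ultimately show ?thesis using W unfolding square_word_eq by blast
qed

theorem theorem1:
  fixes U :: "const letter list"
  assumes "U \<in> carrier FreeA" and "U \<noteq> \<one>\<^bsub>FreeA\<^esub>"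
  shows
    "(\<forall>g \<phi>. genus_plus FreeA U = enat g \<and> solution \<phi> (commutator_word g) U \<longrightarrow>
       (\<exists>W \<psi>. quadratic W \<and> orientable W \<and> irredundant W \<and> genus_plus FreeX W = enat g \<and>
          solution \<psi> W U \<and> cancellation_free \<psi> W U \<and>
          (\<forall>\<gamma>\<in>auto FreeX. \<gamma> W = commutator_word g \<longrightarrow>
             (\<exists>\<alpha>\<in>Stab (commutator_word g). \<forall>x\<in>vars (commutator_word g).
                \<phi> (gen x) = \<psi> (inv_into (carrier FreeX) \<gamma> (\<alpha> (gen x))))))) \<and>
     (\<forall>g \<phi>. genus_minus FreeA U = enat g \<and> enat g \<le> 2 * genus_plus FreeA U \<and>
          solution \<phi> (square_word g) U \<longrightarrow>
       (\<exists>W \<psi>. quadratic W \<and> \<not> orientable W \<and> irredundant W \<and> genus_minus FreeX W = enat g \<and>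
          solution \<psi> W U \<and> cancellation_free \<psi> W U \<and>
          (\<forall>\<gamma>\<in>auto FreeX. \<gamma> W = square_word g \<longrightarrow>
             (\<exists>\<alpha>\<in>Stab (square_word g). \<forall>x\<in>vars (square_word g).
                \<phi> (gen x) = \<psi> (inv_into (carrier FreeX) \<gamma> (\<alpha> (gen x)))))))"
proof -
  have U: "reduced U" "U \<noteq> []" using assms by simp_all
  show ?thesis
    by (intro conjI allI impI; (elim conjE)?)
      (rule orientable_case[OF U(1)] nonorientable_case[OF U]; assumption)+
qed

end
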